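(* Let $\mathbb{B}$ be a Banach space and let $f\in\mathfrak{D}(\mathbb{B})$ satisfy generalized hyperbolicity. Then: (M1) $f$ has the Lipschitz shadowing property; (M2) $f$ has the Lipschitz periodic shadowing property; (M3) periodic points are dense in the chain-recurrent set: $\overline{Per(f)}=CR(f)$; (M4) generalized hyperbolicity is robust in the uniform $C^1$ distance: if $f$ satisfies generalized hyperbolicity with constants $C>0$ and $\lambda\in(0,1)$, then for every $\lambda_1\in(\lambda,1)$ there exist $\delta>0$ and $C_1>0$ such that every $g\in\mathfrak{D}(\mathbb{B})$ with $\|g-f\|_{C^1}<\delta$ satisfies generalized hyperbolicity with constants $C_1$ and $\lambda_1$.
   Context: $\mathbb{B}$ is an arbitrary Banach space with norm $|\cdot|$. $\mathfrak{D}(\mathbb{B})$ is the set of $C^1$-diffeomorphisms $f:\mathbb{B}\to\mathbb{B}$ (Fréchet derivative $Df$) for which there exist $R>0$ and a nondecreasing function $r:\mathbb{R}^+\to\mathbb{R}^+$ with $\lim_{z\to0}r(z)=0$ such that for all $x,v\in\mathbb{B}$, $v\neq0$: $|f(x+v)-f(x)-Df(x)v|\le|v|\,r(|v|)$; $\|Df(x)\|\le R$ and $\|D(f^{-1})(x)\|\le R$; $\|Df(x+v)-Df(x)\|\le r(|v|)$. The extended distance is $\|f-g\|_{C^1}=\sup_x|f(x)-g(x)|+\sup_x\|Df(x)-Dg(x)\|$ (possibly infinite). $f$ satisfies generalized hyperbolicity with constants $C>0$, $\lambda\in(0,1)$ if for every $x\in\mathbb{B}$ there are bounded linear projections $P_x,Q_x:\mathbb{B}\to\mathbb{B}$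 such that, with $E^s_x=P_x(\mathbb{B})$, $E^u_x=Q_x(\mathbb{B})$: (GH1) $P_x+Q_x=Id$, $\|P_x\|,\|Q_x\|\le C$; (GH2) $Df(x)E^s_x\subseteq E^s_{f(x)}$ and $D(f^{-1})(x)E^u_x\subseteq E^u_{f^{-1}(x)}$; (GH3) for every integer $n>0$, $|D(f^n)(x)v|\le C\lambda^n|v|$ for $v\in E^s_x$ and $|D(f^{-n})(x)v|\le C\lambda^n|v|$ for $v\in E^u_x$. No continuity in $x$ is required. $f$ satisfies generalized hyperbolicity if it does so for some constants $C,\lambda$. For $d>0$ and an integer interval $I$, a sequence $\{y_k\}_{k\in I}$ in $\mathbb{B}$ is a $d$-pseudotrajectory of $f$ if $|y_{k+1}-f(y_k)|\le d$ whenever $k,k+1\in I$. An exact trajectory is a sequence with $x_{k+1}=f(x_k)$. Lipschitz shadowing property: there exist $M,d_0>0$ such that for any $d<d_0$ and any $d$-pseudotrajectory $\{y_k\}_{k\in\mathbb{Z}}$ there is an exact trajectory $\{x_k\}_{k\in\mathbb{Z}}$ with $|x_k-y_k|\le Md$ for all $k\in\mathbb{Z}$. Lipschitz periodic shadowing property: there exist $M,d_0>0$ such that for any $d<d_0$ and any $d$-pseudotrajectory $\{y_k\}_{k\in\mathbb{Z}}$ with $y_{k+N}=y_k$ for all $k$ (for some $N>0$) there is an exact trajectory $\{x_k\}_{k\in\mathbb{Z}}$ with $x_{k+N}=x_k$ and $|x_k-y_k|\le Md$ for all $k\in\mathbb{Z}$. $Per(f)$ is the set of periodic points of $f$. $CR(f)$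 is the set of chain-recurrent points: points $x$ such that for any $d>0$ there exist an integer $N\ge1$ and a finite $d$-pseudotrajectory $\{y_k\}_{0\le k\le N}$ with $y_0=y_N=x$. *)

theory Defs
  imports "HOL-Analysis.Analysis"
begin

text \<open>The Frechet derivative as a bounded operator; meaningful at points of differentiability.\<close>

definition fderiv :: "('b::real_normed_vector \<Rightarrow> 'b) \<Rightarrow> 'b \<Rightarrow> 'b \<Rightarrow>\<^sub>L 'b" where
  "fderiv f x = Blinfun (frechet_derivative f (at x))"

definition C1_map :: "('b::real_normed_vector \<Rightarrow> 'b) \<Rightarrow> bool" where
  "C1_map f \<longleftrightarrow> (\<forall>x. f differentiable (at x)) \<and> continuous_on UNIV (fderiv f)"

definition C1_diffeo :: "('b::real_normed_vector \<Rightarrow> 'b) \<Rightarrow> bool" where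
  "C1_diffeo f \<longleftrightarrow> bij f \<and> C1_map f \<and> C1_map (inv f)"

definition uniform_diffeos :: "('b::banach \<Rightarrow> 'b) set" where
  "uniform_diffeos = {f. C1_diffeo f \<and>
     (\<exists>R>0. \<exists>r :: real \<Rightarrow> real.
        r \<in> {0..} \<rightarrow> {0..} \<and> mono_on {0..} r \<and> (r \<longlongrightarrow> 0) (at_right 0) \<and>
        (\<forall>x. norm (fderiv f x) \<le> R \<and> norm (fderiv (inv f) x) \<le> R) \<and>
        (\<forall>x v. v \<noteq> 0 \<longrightarrow>
           norm (f (x + v) - f x - fderiv f x v) \<le> norm v * r (norm v) \<and>
           norm (fderiv f (x + v) - fderiv f x) \<le> r (norm v)))}"

definition C1_dist :: "('b::real_normed_vector \<Rightarrow> 'b) \<Rightarrow> ('b \<Rightarrow> 'b) \<Rightarrow> ennreal" where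
  "C1_dist f g = (SUP x. ennreal (norm (f x - g x))) + (SUP x. ennreal (norm (fderiv f x - fderiv g x)))"

text \<open>The stable space at \<open>x\<close> is \<open>range (P x)\<close>, the unstable one is \<open>range (Q x)\<close>;
  no regularity in \<open>x\<close> is imposed.\<close>

definition generalized_hyperbolic_with :: "('b::banach \<Rightarrow> 'b) \<Rightarrow> real \<Rightarrow> real \<Rightarrow> bool" where
  "generalized_hyperbolic_with f C lam \<longleftrightarrow> C > 0 \<and> 0 < lam \<and> lam < 1 \<and>
     (\<exists>P Q :: 'b \<Rightarrow> 'b \<Rightarrow>\<^sub>L 'b. \<forall>x.
        P x o\<^sub>L P x = P x \<and> Q x o\<^sub>L Q x = Q x \<and>
        P x + Q x = id_blinfun \<and> norm (P x) \<le> C \<and> norm (Q x) \<le> C \<and>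
        fderiv f x ` range (P x) \<subseteq> range (P (f x)) \<and>
        fderiv (inv f) x ` range (Q x) \<subseteq> range (Q (inv f x)) \<and>
        (\<forall>n>0. (\<forall>v \<in> range (P x). norm (fderiv (f ^^ n) x v) \<le> C * lam ^ n * norm v) \<and>
               (\<forall>v \<in> range (Q x). norm (fderiv (inv f ^^ n) x v) \<le> C * lam ^ n * norm v)))"

definition generalized_hyperbolic :: "('b::banach \<Rightarrow> 'b) \<Rightarrow> bool" where
  "generalized_hyperbolic f \<longleftrightarrow> (\<exists>C lam. generalized_hyperbolic_with f C lam)"

definition pseudotrajectory ::
    "('b::real_normed_vector \<Rightarrow> 'b) \<Rightarrow> real \<Rightarrow> int set \<Rightarrow> (int \<Rightarrow> 'b) \<Rightarrow> bool" where
  "pseudotrajectory f d I y \<longleftrightarrow> (\<forall>k. k \<in> I \<and> k + 1 \<in> I \<longrightarrow> norm (y (k + 1) - f (y k)) \<le> d)"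

definition exact_trajectory :: "('b \<Rightarrow> 'b) \<Rightarrow> (int \<Rightarrow> 'b) \<Rightarrow> bool" where
  "exact_trajectory f x \<longleftrightarrow> (\<forall>k. x (k + 1) = f (x k))"

definition Lipschitz_shadowing :: "('b::real_normed_vector \<Rightarrow> 'b) \<Rightarrow> bool" where
  "Lipschitz_shadowing f \<longleftrightarrow> (\<exists>M>0. \<exists>d0>0. \<forall>d y.
     0 < d \<and> d < d0 \<and> pseudotrajectory f d UNIV y \<longrightarrow>
     (\<exists>x. exact_trajectory f x \<and> (\<forall>k. norm (x k - y k) \<le> M * d)))"

definition Lipschitz_periodic_shadowing :: "('b::real_normed_vector \<Rightarrow> 'b) \<Rightarrow> bool" where
  "Lipschitz_periodic_shadowing f \<longleftrightarrow> (\<exists>M>0. \<exists>d0>0. \<forall>d y. \<forall>N>0.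
     0 < d \<and> d < d0 \<and> pseudotrajectory f d UNIV y \<and> (\<forall>k. y (k + N) = y k) \<longrightarrow>
     (\<exists>x. exact_trajectory f x \<and> (\<forall>k. x (k + N) = x k) \<and> (\<forall>k. norm (x k - y k) \<le> M * d)))"

definition Per :: "('b \<Rightarrow> 'b) \<Rightarrow> 'b set" where
  "Per f = {x. \<exists>n>0. (f ^^ n) x = x}"

definition CR :: "('b::real_normed_vector \<Rightarrow> 'b) \<Rightarrow> 'b set" where
  "CR f = {x. \<forall>d>0. \<exists>N\<ge>1. \<exists>y. pseudotrajectory f d {0..N} y \<and> y 0 = x \<and> y N = x}"

end

theory Submission
  imports Defs
begin

text \<open>
  Along a pseudotrajectory the splittings at consecutive points are unrelated. Nevertheless, pushing
  the stable part of an inhomogeneity forward and the unstable part backward along the exact orbit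
  of its own base point, for a fixed large number \<open>n\<close> of steps, inverts the linearized equation up
  to a small error. The nonlinear shadowing equation thereby becomes a contraction on bounded
  sequences, whose unique fixed point depends shift-equivariantly on the pseudotrajectory; this
  gives periodic shadowing, hence the density of periodic points in the chain recurrent set.

  For robustness, every orbit of a perturbation \<open>g\<close> is shadowed equivariantly by an \<open>f\<close>-orbit \<open>z\<close>,
  so \<open>Dg\<close> along it is a small perturbation of \<open>Df\<close> along \<open>z\<close>. The Green operator along \<open>z\<close> takes
  values in the sequences \<open>v\<close> with \<open>v\<^sub>k \<in> W\<^sub>k = E\<^sup>s \<oplus> Df\<inverse> E\<^sup>u\<close>, a pointwise condition. In this class
  the perturbed equation \<open>v (k + 1) = Dg v k + \<delta> w\<close> has exactly one bounded solution, decaying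
  exponentially, and \<open>w \<mapsto> v 0\<close> is the new stable projection. Truncating a solution to one side keeps it
  in the class, so uniqueness makes this map idempotent and its kernel and range invariant.
\<close>

section \<open>Fixed points in weighted sup-norm balls\<close>

lemma weighted_contraction_fixpoint:
  fixes T :: "('a \<Rightarrow> 'c::banach) \<Rightarrow> 'a \<Rightarrow> 'c" and w :: "'a \<Rightarrow> real"
  assumes q: "0 \<le> q" "q < 1" and c: "0 \<le> c" and w: "\<And>k. 0 < w k"
    and maps: "\<And>u. \<forall>k. norm (u k) \<le> c * w k \<Longrightarrow> \<forall>k. norm (T u k) \<le> c * w k"
    and contr: "\<And>u v e. \<lbrakk>0 \<le> e; \<forall>k. norm (u k) \<le> c * w k; \<forall>k. norm (v k) \<le> c * w k;
        \<forall>k. norm (u k - v k) \<le> e * w k\<rbrakk> \<Longrightarrow> \<forall>k. norm (T u k - T v k) \<le> q * e * w k"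
  shows "\<exists>!u. (\<forall>k. norm (u k) \<le> c * w k) \<and> T u = u"
proof -
  have pow0: "(\<lambda>n. q ^ n * e) \<longlonglongrightarrow> 0" for e
    using tendsto_mult_right[OF LIMSEQ_realpow_zero[OF q], of e] by simp
  \<comment> \<open>Picard iteration from zero. Limits are taken index by index, while every bound
    keeps its factor \<open>w k\<close>, so no Banach space of weighted sequences has to be
    built.\<close>
  define U where "U n = (T ^^ n) (\<lambda>_. 0)" for n
  have U_Suc: "U (Suc n) = T (U n)" for n by (simp add: U_def)
  have U0: "U 0 = (\<lambda>_. 0)" by (simp add: U_def)
  have UD: "\<forall>k. norm (U n k) \<le> c * w k" for n
  proof (induction n)
    case 0 then show ?case using c w by (simp add: U0 less_imp_le)
  next
    case (Suc n) then show ?case using maps U_Suc by simp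
  qed
  \<comment> \<open>Comparing iterates \<open>n\<close> and \<open>j + n\<close> in one step avoids
    a geometric series: since \<open>U 0\<close> is zero, the base case is just membership of
    \<open>U j\<close> in the ball.\<close>
  have Udiff: "\<forall>k. norm (U (j + n) k - U n k) \<le> q ^ n * c * w k" for j n
  proof (induction n)
    case 0 then show ?case using UD by (simp add: U0)
  next
    case (Suc n)
    have "\<forall>k. norm (T (U (j + n)) k - T (U n) k) \<le> q * (q ^ n * c) * w k"
      by (rule contr) (use Suc UD q c in auto)
    then show ?case by (simp add: U_Suc mult_ac)
  qed
  have conv: "convergent (\<lambda>n. U n k)" for k
  proof -
    have "Cauchy (\<lambda>n. U n k)"
    proof (rule metric_CauchyI)
      fix e :: real assume e: "0 < e"
      have "(\<lambda>n. q ^ n * (c * w k)) \<longlonglongrightarrow> 0" by (rule pow0)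
      then obtain N where N: "\<And>n. n \<ge> N \<Longrightarrow> q ^ n * (c * w k) < e / 2"
        using order_tendstoD(2)[of _ 0 sequentially "e/2"] e
        unfolding eventually_sequentially by (metis half_gt_zero)
      have "norm (U m k - U N k) < e / 2" if "m \<ge> N" for m
        using Udiff[of "m - N" N] N[of N] that
        by (metis (no_types, lifting) le_add_diff_inverse2 le_less_trans mult.assoc order_refl)
      then show "\<exists>M. \<forall>m\<ge>M. \<forall>n\<ge>M. dist (U m k) (U n k) < e"
        by (metis dist_commute dist_norm dist_triangle_half_l)
    qed
    then show ?thesis by (simp add: Cauchy_convergent_iff)
  qed
  define L where "L k = lim (\<lambda>n. U n k)" for k
  have lim: "(\<lambda>n. U n k) \<longlonglongrightarrow> L k" for k
    using conv by (simp add: L_def convergent_LIMSEQ_iff)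
  have LD: "\<forall>k. norm (L k) \<le> c * w k"
    using UD Lim_bounded[OF tendsto_norm[OF lim]] by blast
  have LU: "\<forall>k. norm (L k - U n k) \<le> q ^ n * c * w k" for n
  proof
    fix k
    have "(\<lambda>j. norm (U (j + n) k - U n k)) \<longlonglongrightarrow> norm (L k - U n k)"
      by (intro tendsto_intros LIMSEQ_ignore_initial_segment lim)
    then show "norm (L k - U n k) \<le> q ^ n * c * w k"
      using Udiff by (blast intro: Lim_bounded)
  qed
  \<comment> \<open>Pointwise convergence alone would not pass through \<open>T\<close>; the rate in
    \<open>LU\<close>, uniform relative to \<open>w\<close>, is what \<open>contr\<close>
    accepts.\<close>
  have TL: "T L = L"
  proof
    fix k
    have "norm (T L k - U (Suc n) k) \<le> q ^ n * (q * c * w k)" for n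
      using contr[of "q ^ n * c" L "U n"] LD UD LU q c by (simp add: U_Suc mult_ac)
    then have "(\<lambda>n. T L k - U (Suc n) k) \<longlonglongrightarrow> 0"
      by (intro Lim_null_comparison[OF _ pow0[of "q * c * w k"]]) auto
    then have "(\<lambda>n. T L k - (T L k - U (Suc n) k)) \<longlonglongrightarrow> T L k - 0"
      by (intro tendsto_diff tendsto_const)
    then have "(\<lambda>n. U (Suc n) k) \<longlonglongrightarrow> T L k" by simp
    then show "T L k = L k"
      using LIMSEQ_Suc[OF lim] LIMSEQ_unique by blast
  qed
  show ?thesis
  proof (rule ex1I[of _ L])
    show "(\<forall>k. norm (L k) \<le> c * w k) \<and> T L = L" using LD TL by blast
  next
    fix u assume u: "(\<forall>k. norm (u k) \<le> c * w k) \<and> T u = u"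
    have "\<forall>k. norm (u k - L k) \<le> q ^ n * (2 * c) * w k" for n
    proof (induction n)
      case 0
      have "norm (u k - L k) \<le> c * w k + c * w k" for k
        using norm_triangle_ineq4[of "u k" "L k"] u LD by (meson add_mono order_trans)
      then show ?case by (simp add: mult.assoc)
    next
      case (Suc n)
      have "\<forall>k. norm (T u k - T L k) \<le> q * (q ^ n * (2 * c)) * w k"
        by (rule contr) (use Suc u LD q c in auto)
      then show ?case using u TL by (simp add: mult_ac)
    qed
    then have "norm (u k - L k) \<le> 0" for k
      using LIMSEQ_le_const[OF pow0[of "2 * c * w k"], of "norm (u k - L k)"] by (metis mult.assoc)
    then show "u = L" by auto
  qed
qed

section \<open>Derivatives of compositions, inverses and iterates\<close>

lemma has_derivative_fderiv:
  "f differentiable at x \<Longrightarrow> (f has_derivative blinfun_apply (fderiv f x)) (at x)"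
  unfolding fderiv_def
  by (simp add: bounded_linear_Blinfun_apply frechet_derivative_works has_derivative_bounded_linear)

lemma fderiv_eqI: "(f has_derivative blinfun_apply D) (at x) \<Longrightarrow> fderiv f x = D"
  unfolding fderiv_def by (metis blinfun_apply_inverse frechet_derivative_at)

lemma fderiv_id: "fderiv id x = id_blinfun"
  by (rule fderiv_eqI) (simp add: id_def id_blinfun.rep_eq)

lemma fderiv_compose:
  assumes "f differentiable at x" "g differentiable at (f x)"
  shows "fderiv (g \<circ> f) x = fderiv g (f x) o\<^sub>L fderiv f x"
proof (rule fderiv_eqI)
  show "(g \<circ> f has_derivative blinfun_apply (fderiv g (f x) o\<^sub>L fderiv f x)) (at x)"
    using diff_chain_at[OF assms[THEN has_derivative_fderiv]] by (simp add: comp_def blinfun_compose.rep_eq)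
qed

lemma differentiable_funpow:
  fixes f :: "'b::real_normed_vector \<Rightarrow> 'b"
  assumes "\<And>x. f differentiable at x"
  shows "(f ^^ n) differentiable at x"
proof (induction n)
  case 0 then show ?case by (simp add: id_def)
next
  case (Suc n) then show ?case
    unfolding funpow.simps by (intro differentiable_chain_at assms)
qed

lemma fderiv_funpow_Suc:
  fixes f :: "'b::real_normed_vector \<Rightarrow> 'b"
  assumes "\<And>x. f differentiable at x"
  shows "fderiv (f ^^ Suc n) x v = fderiv f ((f ^^ n) x) (fderiv (f ^^ n) x v)"
    and "fderiv (f ^^ Suc n) x v = fderiv (f ^^ n) (f x) (fderiv f x v)"
proof -
  note d = assms differentiable_funpow[OF assms]
  show "fderiv (f ^^ Suc n) x v = fderiv f ((f ^^ n) x) (fderiv (f ^^ n) x v)"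
    using fderiv_compose[OF d(2) d(1)] by simp
  show "fderiv (f ^^ Suc n) x v = fderiv (f ^^ n) (f x) (fderiv f x v)"
    unfolding funpow_Suc_right using fderiv_compose[OF d(1) d(2)] by simp
qed

lemma C1_diffeoD:
  assumes "C1_diffeo f"
  shows "bij f" "f differentiable at x" "inv f differentiable at x"
    "inv f (f x) = x" "f (inv f x) = x"
  using assms unfolding C1_diffeo_def C1_map_def
  by (auto simp: bij_is_inj bij_is_surj surj_f_inv_f)

lemma fderiv_inv_apply:
  assumes "C1_diffeo f"
  shows "fderiv (inv f) (f x) (fderiv f x v) = v" "fderiv f (inv f x) (fderiv (inv f) x v) = v"
proof -
  note d = C1_diffeoD[OF assms]
  have "inv f \<circ> f = id" "f \<circ> inv f = id" using d(4,5) by auto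
  then have "fderiv (inv f) (f x) o\<^sub>L fderiv f x = id_blinfun"
    "fderiv f (inv f x) o\<^sub>L fderiv (inv f) x = id_blinfun"
    using fderiv_compose[of f x "inv f"] fderiv_compose[of "inv f" x f] d fderiv_id by metis+
  then show "fderiv (inv f) (f x) (fderiv f x v) = v" "fderiv f (inv f x) (fderiv (inv f) x v) = v"
    by (metis blinfun_apply_blinfun_compose blinfun_apply_id_blinfun id_apply)+
qed

lemma fderiv_bound_imp_lipschitz:
  fixes f :: "'b::real_normed_vector \<Rightarrow> 'b"
  assumes "\<And>x. f differentiable at x" "\<And>x. norm (fderiv f x) \<le> R"
  shows "norm (f x - f y) \<le> R * norm (x - y)"
proof (rule differentiable_bound[of UNIV])
  show "(f has_derivative blinfun_apply (fderiv f x)) (at x within UNIV)" for x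
    using has_derivative_fderiv[OF assms(1)] .
  show "onorm (blinfun_apply (fderiv f x)) \<le> R" for x
    using assms(2) by (simp add: norm_blinfun.rep_eq)
qed auto

section \<open>Weights and orbits\<close>

text \<open>The weight changes by at most a factor \<open>1 / m\<close> per step in either
  direction, so a rate \<open>lam < m\<close> survives as \<open>lam / m\<close>. The constant
  weight serves shadowing, and \<open>m ^ nat \<bar>k\<bar>\<close> yields exponential decay from
  the same estimates.\<close>

definition slow_weight :: "real \<Rightarrow> (int \<Rightarrow> real) \<Rightarrow> bool" where
  "slow_weight m w \<longleftrightarrow> 0 < m \<and> m \<le> 1 \<and> (\<forall>k. 0 < w k \<and> m * w k \<le> w (k + 1) \<and> m * w (k + 1) \<le> w k)"

lemma slow_weight_const: "slow_weight 1 (\<lambda>_. 1)"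
  by (simp add: slow_weight_def)

lemma slow_weight_power:
  assumes "0 < m" "m \<le> 1"
  shows "slow_weight m (\<lambda>k. m ^ nat \<bar>k\<bar>)"
  unfolding slow_weight_def
proof (intro conjI allI assms)
  fix k :: int
  show "0 < m ^ nat \<bar>k\<bar>" using assms by simp
  have "nat \<bar>k + 1\<bar> \<le> Suc (nat \<bar>k\<bar>)" "nat \<bar>k\<bar> \<le> Suc (nat \<bar>k + 1\<bar>)" by linarith+
  then show "m * m ^ nat \<bar>k\<bar> \<le> m ^ nat \<bar>k + 1\<bar>" "m * m ^ nat \<bar>k + 1\<bar> \<le> m ^ nat \<bar>k\<bar>"
    using power_decreasing[of _ _ m] assms by (fastforce simp flip: power_Suc)+
qed

lemma slow_weight_iterate:
  assumes "slow_weight m w"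
  shows "m ^ i * w (k - int i) \<le> w k" "m ^ i * w (k + int i) \<le> w k"
proof -
  have m: "0 < m" and step: "m * w k \<le> w (k + 1)" "m * w (k + 1) \<le> w k" for k
    using assms by (auto simp: slow_weight_def)
  show "m ^ i * w (k - int i) \<le> w k"
  proof (induction i)
    case (Suc i)
    have "m ^ i * (m * w (k - int (Suc i))) \<le> m ^ i * w (k - int i)"
      using step(1)[of "k - int (Suc i)"] m by (intro mult_left_mono) (auto simp: algebra_simps)
    then show ?case using Suc by (simp add: mult_ac)
  qed simp
  show "m ^ i * w (k + int i) \<le> w k"
  proof (induction i)
    case (Suc i)
    have "m ^ i * (m * w (k + int (Suc i))) \<le> m ^ i * w (k + int i)"
      using step(2)[of "k + int i"] m by (intro mult_left_mono) (auto simp: algebra_simps)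
    then show ?case using Suc by (simp add: mult_ac)
  qed simp
qed

lemma exact_trajectory_iterate:
  assumes "bij f" "exact_trajectory f y"
  shows "(f ^^ i) (y k) = y (k + int i)" "(inv f ^^ i) (y k) = y (k - int i)"
proof -
  have y: "y (k + 1) = f (y k)" for k using assms(2) by (simp add: exact_trajectory_def)
  show "(f ^^ i) (y k) = y (k + int i)"
  proof (induction i)
    case (Suc i) then show ?case using y[of "k + int i"] by (simp add: add_ac)
  qed simp
  show "(inv f ^^ i) (y k) = y (k - int i)"
  proof (induction i)
    case (Suc i)
    have "y (k - int i) = f (y (k - int (Suc i)))" using y[of "k - int (Suc i)"] by (simp add: algebra_simps)
    then show ?case using Suc bij_is_inj[OF assms(1)] by simp
  qed simp
qed

definition orbit :: "('a \<Rightarrow> 'a) \<Rightarrow> 'a \<Rightarrow> int \<Rightarrow> 'a" where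
  "orbit g x k = (if 0 \<le> k then (g ^^ nat k) x else (inv g ^^ nat (- k)) x)"

lemma exact_trajectory_orbit:
  assumes g: "bij g"
  shows "exact_trajectory g (orbit g x)"
  unfolding exact_trajectory_def
proof
  fix k :: int
  consider "0 \<le> k" | "k = - 1" | "k < - 1" by linarith
  then show "orbit g x (k + 1) = g (orbit g x k)"
  proof cases
    case 1 then show ?thesis by (simp add: orbit_def nat_add_distrib)
  next
    case 2 then show ?thesis using g by (simp add: orbit_def bij_is_surj surj_f_inv_f)
  next
    case 3
    then have "nat (- k) = Suc (nat (- (k + 1)))" by simp
    then show ?thesis using 3 g by (simp add: orbit_def bij_is_surj surj_f_inv_f)
  qed
qed

lemma orbit_shift:
  assumes g: "bij g"
  shows "orbit g (orbit g x m) = (\<lambda>k. orbit g x (k + m))"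
proof
  fix k
  note it = exact_trajectory_iterate[OF g exact_trajectory_orbit[OF g], of _ x m]
  show "orbit g (orbit g x m) k = orbit g x (k + m)"
    unfolding orbit_def[of g "orbit g x m"] using it(1)[of "nat k"] it(2)[of "nat (- k)"]
    by (auto simp: add_ac)
qed

lemma generalized_hyperbolic_withI:
  fixes P Q :: "'b::banach \<Rightarrow> 'b \<Rightarrow>\<^sub>L 'b"
  assumes "0 < C" "0 < lam" "lam < 1"
    and "\<And>x. P x o\<^sub>L P x = P x" "\<And>x. Q x o\<^sub>L Q x = Q x" "\<And>x. P x + Q x = id_blinfun"
    and "\<And>x. norm (P x) \<le> C" "\<And>x. norm (Q x) \<le> C"
    and "\<And>x. fderiv f x ` range (P x) \<subseteq> range (P (f x))"
    and "\<And>x. fderiv (inv f) x ` range (Q x) \<subseteq> range (Q (inv f x))"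
    and "\<And>n x v. \<lbrakk>0 < n; v \<in> range (P x)\<rbrakk> \<Longrightarrow> norm (fderiv (f ^^ n) x v) \<le> C * lam ^ n * norm v"
    and "\<And>n x v. \<lbrakk>0 < n; v \<in> range (Q x)\<rbrakk> \<Longrightarrow> norm (fderiv (inv f ^^ n) x v) \<le> C * lam ^ n * norm v"
  shows "generalized_hyperbolic_with f C lam"
  unfolding generalized_hyperbolic_with_def using assms by metis

section \<open>Shadowing\<close>

locale hyperbolic_diffeo =
  fixes f :: "'b::banach \<Rightarrow> 'b" and P Q :: "'b \<Rightarrow> 'b \<Rightarrow>\<^sub>L 'b" and C lam R :: real
  assumes diffeo: "C1_diffeo f"
    and R_pos: "0 < R"
    and deriv_bound: "\<And>x. norm (fderiv f x) \<le> R" "\<And>x. norm (fderiv (inv f) x) \<le> R"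
    and deriv_unif: "\<And>e. 0 < e \<Longrightarrow> \<exists>t>0. \<forall>x v. norm v \<le> t \<longrightarrow> norm (fderiv f (x + v) - fderiv f x) \<le> e"
    and C_pos: "0 < C" and lam: "0 < lam" "lam < 1"
    and P_idem: "\<And>x. P x o\<^sub>L P x = P x" and Q_idem: "\<And>x. Q x o\<^sub>L Q x = Q x"
    and PQ: "\<And>x. P x + Q x = id_blinfun"
    and P_norm: "\<And>x. norm (P x) \<le> C" and Q_norm: "\<And>x. norm (Q x) \<le> C"
    and P_invariant: "\<And>x. fderiv f x ` range (P x) \<subseteq> range (P (f x))"
    and Q_invariant: "\<And>x. fderiv (inv f) x ` range (Q x) \<subseteq> range (Q (inv f x))"
    and P_contracts: "\<And>n x v. \<lbrakk>0 < n; v \<in> range (P x)\<rbrakk> \<Longrightarrow> norm (fderiv (f ^^ n) x v) \<le> C * lam ^ n * norm v"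
    and Q_contracts: "\<And>n x v. \<lbrakk>0 < n; v \<in> range (Q x)\<rbrakk> \<Longrightarrow> norm (fderiv (inv f ^^ n) x v) \<le> C * lam ^ n * norm v"
begin

lemmas bij_f = C1_diffeoD(1)[OF diffeo]
lemmas diff = C1_diffeoD(2,3)[OF diffeo]
lemmas inv_cancel [simp] = C1_diffeoD(4,5)[OF diffeo]

lemma splitting: "P x v + Q x v = v"
  by (metis PQ plus_blinfun.rep_eq blinfun_apply_id_blinfun id_apply)

lemma P_P [simp]: "P x (P x v) = P x v"
  by (metis P_idem blinfun_apply_blinfun_compose)

lemma Q_Q [simp]: "Q x (Q x v) = Q x v"
  by (metis Q_idem blinfun_apply_blinfun_compose)

lemma Q_P [simp]: "Q x (P x v) = 0"
  using splitting[of x "P x v"] by simp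

lemma P_Q [simp]: "P x (Q x v) = 0"
  using splitting[of x "Q x v"] by simp

section \<open>Transport of stable components forward and unstable components backward\<close>

definition H :: real where "H = C + C * C"

lemma H_pos: "0 < H"
  using C_pos by (simp add: H_def add_pos_pos)

definition Fw :: "nat \<Rightarrow> 'b \<Rightarrow> 'b \<Rightarrow> 'b" where "Fw i x v = fderiv (f ^^ i) x (P x v)"
definition Bw :: "nat \<Rightarrow> 'b \<Rightarrow> 'b \<Rightarrow> 'b" where "Bw i x v = fderiv (inv f ^^ i) x (Q x v)"

lemma Fw_0: "Fw 0 x v = P x v"
  using fderiv_id[where 'a = 'b] by (simp add: Fw_def id_def[symmetric])

lemma Bw_0: "Bw 0 x v = Q x v"
  using fderiv_id[where 'a = 'b] by (simp add: Bw_def id_def[symmetric])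

lemma Fw_linear: "Fw i x (u + v) = Fw i x u + Fw i x v" "Fw i x (u - v) = Fw i x u - Fw i x v"
  by (simp_all add: Fw_def blinfun.add_right blinfun.diff_right)

lemma Bw_linear: "Bw i x (u + v) = Bw i x u + Bw i x v" "Bw i x (u - v) = Bw i x u - Bw i x v"
  by (simp_all add: Bw_def blinfun.add_right blinfun.diff_right)

lemma Fw_Suc: "fderiv f ((f ^^ i) x) (Fw i x v) = Fw (Suc i) x v"
  unfolding Fw_def by (rule fderiv_funpow_Suc(1)[OF diff(1), symmetric])

text \<open>Applying the derivative of \<open>f\<close> undoes one backward step, so the backward
  terms, like the forward ones, solve the homogeneous linearized equation along the orbit of
  \<open>x\<close>.\<close>

lemma Bw_Suc: "fderiv f ((inv f ^^ Suc i) x) (Bw (Suc i) x v) = Bw i x v"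
  unfolding Bw_def fderiv_funpow_Suc(1)[OF diff(2)]
  using fderiv_inv_apply(2)[OF diffeo] by simp

text \<open>The hyperbolic estimate is available only for \<open>i > 0\<close>, where it costs
  \<open>C\<close> for the contraction and \<open>C\<close> for the projection; for
  \<open>i = 0\<close> the projection alone costs \<open>C\<close>. The sum \<open>H\<close> covers
  both cases.\<close>

lemma Fw_bound: "norm (Fw i x v) \<le> H * lam ^ i * norm v"
proof (cases "i = 0")
  case True
  have "norm (P x v) \<le> norm (P x) * norm v" by (rule norm_blinfun)
  also have "\<dots> \<le> H * norm v"
    using P_norm[of x] C_pos by (intro mult_right_mono) (auto simp: H_def intro: add_increasing2)
  finally show ?thesis using True by (simp add: Fw_0)
next
  case False
  have "norm (P x v) \<le> C * norm v"
    using norm_blinfun[of "P x" v] P_norm[of x] by (meson mult_right_mono norm_ge_zero order_trans)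
  then have "C * lam ^ i * norm (P x v) \<le> C * lam ^ i * (C * norm v)"
    using C_pos lam by (intro mult_left_mono) auto
  also have "\<dots> \<le> H * lam ^ i * norm v"
    using C_pos lam by (simp add: H_def algebra_simps)
  finally show ?thesis using P_contracts[of i "P x v" x] False by (simp add: Fw_def)
qed

lemma Bw_bound: "norm (Bw i x v) \<le> H * lam ^ i * norm v"
proof (cases "i = 0")
  case True
  have "norm (Q x v) \<le> norm (Q x) * norm v" by (rule norm_blinfun)
  also have "\<dots> \<le> H * norm v"
    using Q_norm[of x] C_pos by (intro mult_right_mono) (auto simp: H_def intro: add_increasing2)
  finally show ?thesis using True by (simp add: Bw_0)
next
  case False
  have "norm (Q x v) \<le> C * norm v"
    using norm_blinfun[of "Q x" v] Q_norm[of x] by (meson mult_right_mono norm_ge_zero order_trans)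
  then have "C * lam ^ i * norm (Q x v) \<le> C * lam ^ i * (C * norm v)"
    using C_pos lam by (intro mult_left_mono) auto
  also have "\<dots> \<le> H * lam ^ i * norm v"
    using C_pos lam by (simp add: H_def algebra_simps)
  finally show ?thesis using Q_contracts[of i "Q x v" x] False by (simp add: Bw_def)
qed

text \<open>Moving the weight over \<open>i\<close> indices costs at most \<open>m ^ i\<close> in
  the denominator, which is absorbed into the contraction rate.\<close>

lemma Fw_Bw_weighted:
  assumes w: "slow_weight m w" and m: "lam \<le> m" and u: "\<And>k. norm (u k) \<le> c * w k"
  shows "norm (Fw i x (u (k - int i))) \<le> H * (lam / m) ^ i * (c * w k)"
    and "norm (Bw i x (u (k + int i))) \<le> H * (lam / m) ^ i * (c * w k)"
proof -
  have m0: "0 < m" and w0: "\<And>k. 0 < w k" using w by (auto simp: slow_weight_def)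
  have c: "0 \<le> c" using u[of 0] w0[of 0] norm_ge_zero[of "u 0"]
    by (smt (verit) mult_less_0_iff)
  have *: "H * lam ^ i * norm (u j) \<le> H * (lam / m) ^ i * (c * w k)" if "m ^ i * w j \<le> w k" for j
  proof -
    have "norm (u j) \<le> c * (w k / m ^ i)"
      using u[of j] that c m0
      by (smt (verit, best) mult.commute mult_left_mono pos_le_divide_eq zero_less_power)
    then have "H * lam ^ i * norm (u j) \<le> H * lam ^ i * (c * (w k / m ^ i))"
      using H_pos lam by (intro mult_left_mono) auto
    then show ?thesis by (simp add: power_divide)
  qed
  show "norm (Fw i x (u (k - int i))) \<le> H * (lam / m) ^ i * (c * w k)"
    using Fw_bound *[OF slow_weight_iterate(1)[OF w]] order_trans by blast
  show "norm (Bw i x (u (k + int i))) \<le> H * (lam / m) ^ i * (c * w k)"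
    using Bw_bound *[OF slow_weight_iterate(2)[OF w]] order_trans by blast
qed

lemma Fw_Bw_weighted':
  assumes w: "slow_weight m w" and m: "lam \<le> m" and u: "\<And>k. norm (u k) \<le> c * w k"
  shows "norm (Fw i x (u (k - int i))) \<le> H * (c * w k)"
    and "norm (Bw (Suc i) x (u (k + 1 + int i))) \<le> H * (c * w k)"
proof -
  have m0: "0 < m" and w0: "\<And>k. 0 < w k" using w by (auto simp: slow_weight_def)
  have "0 \<le> c * w k" using u[of k] norm_ge_zero order_trans by blast
  moreover have "(lam / m) ^ i \<le> 1" for i using lam m m0 by (intro power_le_one) auto
  ultimately have *: "H * (lam / m) ^ i * (c * w k) \<le> H * (c * w k)" for i
    using H_pos by (metis mult.right_neutral mult_left_mono mult_right_mono order_less_imp_le)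
  show "norm (Fw i x (u (k - int i))) \<le> H * (c * w k)"
    using Fw_Bw_weighted(1)[OF w m u] * order_trans by blast
  have "norm (Bw (Suc i) x (u (k + int (Suc i)))) \<le> H * (c * w k)"
    using Fw_Bw_weighted(2)[OF w m u] * order_trans by blast
  then show "norm (Bw (Suc i) x (u (k + 1 + int i))) \<le> H * (c * w k)"
    by (simp add: add_ac)
qed

text \<open>The truncated Green operator. Every summand uses the splitting at a single point of \<open>y\<close>
  and its exact \<open>f\<close>-orbit, so splittings at different points are never compared.\<close>

definition green :: "nat \<Rightarrow> (int \<Rightarrow> 'b) \<Rightarrow> (int \<Rightarrow> 'b) \<Rightarrow> int \<Rightarrow> 'b" where
  "green n y u k = (\<Sum>i<n. Fw i (y (k - int i)) (u (k - int i)))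
     - (\<Sum>i<n. Bw (Suc i) (y (k + 1 + int i)) (u (k + 1 + int i)))"

lemma green_diff: "green n y (\<lambda>k. u k - v k) k = green n y u k - green n y v k"
  by (simp add: green_def Fw_linear Bw_linear sum_subtractf)

text \<open>The splitting depends only on the point and never on the index; this is the source of
  all later shift compatibility.\<close>

lemma green_shift: "green n (\<lambda>k. y (k + m)) (\<lambda>k. u (k + m)) k = green n y u (k + m)"
  by (simp add: green_def algebra_simps)

lemma green_bound:
  assumes w: "slow_weight m w" and m: "lam \<le> m" and u: "\<And>k. norm (u k) \<le> c * w k"
  shows "norm (green n y u k) \<le> 2 * real n * H * (c * w k)"
proof -
  have "norm (green n y u k) \<le> (\<Sum>i<n. H * (c * w k)) + (\<Sum>i<n. H * (c * w k))"
    unfolding green_def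
    by (intro order_trans[OF norm_triangle_ineq4] add_mono sum_norm_le Fw_Bw_weighted'[OF w m u])
  then show ?thesis by (simp add: algebra_simps)
qed

text \<open>The operator \<open>green n y\<close> is an approximate right inverse of the map sending
  \<open>v\<close> to \<open>v (k + 1) - B k (v k)\<close>. If \<open>B\<close> were exactly the
  derivative along each short orbit, the sums would telescope up to two tails of order
  \<open>(lam / m) ^ n\<close>. Replacing those derivatives by \<open>B\<close> costs
  \<open>e\<close> in each of the \<open>2 * n\<close> terms; the factor \<open>1 / m\<close> comes
  from comparing \<open>w k\<close> with \<open>w (k + 1)\<close>.\<close>

lemma green_residual:
  fixes B :: "int \<Rightarrow> 'b \<Rightarrow>\<^sub>L 'b"
  assumes w: "slow_weight m w" and m: "lam \<le> m" and u: "\<And>k. norm (u k) \<le> c * w k"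
    and fwd: "\<And>j i. i < n \<Longrightarrow> norm (B (j + int i) - fderiv f ((f ^^ i) (y j))) \<le> e"
    and bwd: "\<And>j i. i < n \<Longrightarrow> norm (B (j - int (Suc i)) - fderiv f ((inv f ^^ Suc i) (y j))) \<le> e"
    and e: "0 \<le> e"
  shows "norm (u (k + 1) - green n y u (k + 1) + B k (green n y u k))
    \<le> (2 * H * (lam / m) ^ n + 2 * real n * H * e / m) * (c * w (k + 1))"
proof -
  define a where "a i = Fw i (y (k + 1 - int i)) (u (k + 1 - int i))" for i
  define b where "b i = Bw i (y (k + 1 + int i)) (u (k + 1 + int i))" for i
  define F where "F i = Fw i (y (k - int i)) (u (k - int i))" for i
  define G where "G i = Bw (Suc i) (y (k + 1 + int i)) (u (k + 1 + int i))" for i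
  define f1 where "f1 i = fderiv f ((f ^^ i) (y (k - int i)))" for i
  define f2 where "f2 i = fderiv f ((inv f ^^ Suc i) (y (k + 1 + int i)))" for i
  have f1: "f1 i (F i) = a (Suc i)" for i
    unfolding f1_def F_def Fw_Suc by (simp add: a_def)
  have f2: "f2 i (G i) = b i" for i
    unfolding f2_def G_def Bw_Suc b_def ..
  have g1: "green n y u (k + 1) = (\<Sum>i<n. a i) - (\<Sum>i<n. b (Suc i))"
    by (simp add: green_def a_def b_def add_ac)
  have g0: "green n y u k = (\<Sum>i<n. F i) - (\<Sum>i<n. G i)"
    by (simp add: green_def F_def G_def)
  have "B k (green n y u k) = (\<Sum>i<n. B k (F i)) - (\<Sum>i<n. B k (G i))"
    by (simp add: g0 blinfun.diff_right blinfun.sum_right)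
  also have "(\<Sum>i<n. B k (F i)) = (\<Sum>i<n. (B k - f1 i) (F i)) + (\<Sum>i<n. a (Suc i))"
    by (simp add: minus_blinfun.rep_eq f1 sum_subtractf)
  also have "(\<Sum>i<n. B k (G i)) = (\<Sum>i<n. (B k - f2 i) (G i)) + (\<Sum>i<n. b i)"
    by (simp add: minus_blinfun.rep_eq f2 sum_subtractf)
  finally have B: "B k (green n y u k) = (\<Sum>i<n. (B k - f1 i) (F i)) + (\<Sum>i<n. a (Suc i))
    - ((\<Sum>i<n. (B k - f2 i) (G i)) + (\<Sum>i<n. b i))" .
  have tel: "(\<Sum>i<n. a (Suc i)) = (\<Sum>i<n. a i) + a n - a 0"
    "(\<Sum>i<n. b (Suc i)) = (\<Sum>i<n. b i) + b n - b 0"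
    using sum_lessThan_telescope[of a n] sum_lessThan_telescope[of b n]
    by (auto simp: sum_subtractf algebra_simps)
  have ab0: "u (k + 1) = a 0 + b 0"
    by (simp add: a_def b_def Fw_0 Bw_0 splitting)
  \<comment> \<open>The terms of index 0 are the two projections of \<open>u (k + 1)\<close> at the
    single point \<open>y (k + 1)\<close>, so they recombine and cancel it. Only the terms of index
    \<open>n\<close> and the replacement errors remain.\<close>
  have eq: "u (k + 1) - green n y u (k + 1) + B k (green n y u k)
    = (a n + b n) + ((\<Sum>i<n. (B k - f1 i) (F i)) - (\<Sum>i<n. (B k - f2 i) (G i)))"
    unfolding B g1 tel ab0 by (simp add: algebra_simps)
  have cw: "c * w k \<le> c * w (k + 1) / m"
  proof -
    have "0 < m" "0 < w k" "m * w k \<le> w (k + 1)" using w by (auto simp: slow_weight_def)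
    moreover have "0 \<le> c" using u[of k] norm_ge_zero[of "u k"] \<open>0 < w k\<close>
      by (smt (verit) mult_less_0_iff)
    ultimately show ?thesis
      using mult_left_mono[of "m * w k" "w (k + 1)" c] by (simp add: pos_le_divide_eq mult_ac)
  qed
  have n1: "norm (B k - f1 i) \<le> e" if "i < n" for i
    using fwd[OF that, of "k - int i"] by (simp add: f1_def)
  have n2: "norm (B k - f2 i) \<le> e" if "i < n" for i
    using bwd[OF that, of "k + 1 + int i"] by (simp add: f2_def)
  have F: "norm (F i) \<le> H * (c * w (k + 1) / m)" "norm (G i) \<le> H * (c * w (k + 1) / m)" for i
    using Fw_Bw_weighted'[OF w m u, of i _ k] cw H_pos
    unfolding F_def G_def by (meson mult_left_mono order_less_imp_le order_trans)+
  define E where "E = e * (H * (c * w (k + 1) / m))"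
  have F': "norm ((B k - f1 i) (F i)) \<le> E" "norm ((B k - f2 i) (G i)) \<le> E" if "i < n" for i
    unfolding E_def using n1[OF that] n2[OF that] F e
    by (meson mult_mono norm_blinfun norm_ge_zero order_trans)+
  have "norm (u (k + 1) - green n y u (k + 1) + B k (green n y u k))
    \<le> (H * (lam / m) ^ n * (c * w (k + 1)) + H * (lam / m) ^ n * (c * w (k + 1)))
      + ((\<Sum>i<n. E) + (\<Sum>i<n. E))"
    unfolding eq
    by (intro order_trans[OF norm_triangle_ineq] order_trans[OF norm_triangle_ineq4] add_mono sum_norm_le)
      (auto simp: a_def b_def F' intro: Fw_Bw_weighted[OF w m u])
  then show ?thesis by (simp add: E_def algebra_simps)
qed

section \<open>Pseudotrajectories compared with exact orbit segments\<close>

lemma pseudotrajectory_close: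
  assumes y: "pseudotrajectory f d UNIV y" and d: "0 \<le> d"
  shows "norm ((f ^^ i) (y j) - y (j + int i)) \<le> d * (real i * (R + 1) ^ i)"
    and "norm ((inv f ^^ i) (y j) - y (j - int i)) \<le> d * (real i * (R + 1) ^ i)"
proof -
  have lip: "norm (f a - f b) \<le> R * norm (a - b)" "norm (inv f a - inv f b) \<le> R * norm (a - b)" for a b
    by (intro fderiv_bound_imp_lipschitz diff deriv_bound)+
  have jump: "norm (f (y k) - y (k + 1)) \<le> d" for k
    using y by (simp add: pseudotrajectory_def norm_minus_commute)
  have jump_inv: "norm (inv f (y k) - y (k - 1)) \<le> R * d" for k
  proof -
    have "norm (inv f (y k) - inv f (f (y (k - 1)))) \<le> R * norm (y k - f (y (k - 1)))"
      by (rule lip)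
    also have "\<dots> \<le> R * d"
      using jump[of "k - 1"] R_pos by (intro mult_left_mono) (auto simp: norm_minus_commute)
    finally show ?thesis by simp
  qed
  \<comment> \<open>One recursion serves both time directions: old errors grow by \<open>R\<close>,
    and a new jump adds \<open>d\<close> forward or \<open>R * d\<close> backward, both at most
    \<open>max 1 R * d\<close>.\<close>
  have step: "R * (d * (real i * (R + 1) ^ i)) + max 1 R * d \<le> d * (real (Suc i) * (R + 1) ^ Suc i)" for i
  proof -
    have p: "1 \<le> (R + 1) ^ i" using R_pos by (intro one_le_power) auto
    have "max 1 R \<le> (R + 1) * 1" using R_pos by auto
    also have "\<dots> \<le> (R + 1) * (R + 1) ^ i" using p R_pos by (intro mult_left_mono) auto
    finally have "R * (real i * (R + 1) ^ i) + max 1 R \<le> (R + 1) * (real i * (R + 1) ^ i) + (R + 1) * (R + 1) ^ i"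
      using R_pos by (intro add_mono mult_right_mono) auto
    then have "R * (real i * (R + 1) ^ i) + max 1 R \<le> real (Suc i) * (R + 1) ^ Suc i"
      by (simp add: algebra_simps)
    from mult_left_mono[OF this d] show ?thesis by (simp add: algebra_simps)
  qed
  show "norm ((f ^^ i) (y j) - y (j + int i)) \<le> d * (real i * (R + 1) ^ i)"
  proof (induction i)
    case (Suc i)
    have "norm ((f ^^ Suc i) (y j) - y (j + int (Suc i)))
        \<le> norm (f ((f ^^ i) (y j)) - f (y (j + int i))) + norm (f (y (j + int i)) - y (j + int i + 1))"
      using norm_triangle_ineq[of "f ((f ^^ i) (y j)) - f (y (j + int i))" "f (y (j + int i)) - y (j + int i + 1)"]
      by (simp add: add_ac)
    also have "\<dots> \<le> R * (d * (real i * (R + 1) ^ i)) + max 1 R * d"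
    proof (rule add_mono)
      show "norm (f ((f ^^ i) (y j)) - f (y (j + int i))) \<le> R * (d * (real i * (R + 1) ^ i))"
        using lip(1) Suc R_pos by (meson mult_left_mono order_less_imp_le order_trans)
      have "1 * d \<le> max 1 R * d" using d by (intro mult_right_mono) auto
      then show "norm (f (y (j + int i)) - y (j + int i + 1)) \<le> max 1 R * d"
        using jump[of "j + int i"] by simp
    qed
    finally show ?case using step order_trans by blast
  qed simp
  show "norm ((inv f ^^ i) (y j) - y (j - int i)) \<le> d * (real i * (R + 1) ^ i)"
  proof (induction i)
    case (Suc i)
    have "norm ((inv f ^^ Suc i) (y j) - y (j - int (Suc i)))
        \<le> norm (inv f ((inv f ^^ i) (y j)) - inv f (y (j - int i))) + norm (inv f (y (j - int i)) - y (j - int i - 1))"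
      using norm_triangle_ineq[of "inv f ((inv f ^^ i) (y j)) - inv f (y (j - int i))" "inv f (y (j - int i)) - y (j - int i - 1)"]
      by (simp add: algebra_simps)
    also have "\<dots> \<le> R * (d * (real i * (R + 1) ^ i)) + max 1 R * d"
    proof (rule add_mono)
      show "norm (inv f ((inv f ^^ i) (y j)) - inv f (y (j - int i))) \<le> R * (d * (real i * (R + 1) ^ i))"
        using lip(2) Suc R_pos by (meson mult_left_mono order_less_imp_le order_trans)
      have "R * d \<le> max 1 R * d" using d by (intro mult_right_mono) auto
      then show "norm (inv f (y (j - int i)) - y (j - int i - 1)) \<le> max 1 R * d"
        using jump_inv[of "j - int i"] by simp
    qed
    finally show ?case using step order_trans by blast
  qed simp
qed

lemma deriv_close:
  assumes "0 < e"
  obtains t where "0 < t" "\<And>x y. norm (x - y) \<le> t \<Longrightarrow> norm (fderiv f x - fderiv f y) \<le> e"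
proof -
  obtain t where t: "0 < t" "\<And>x v. norm v \<le> t \<Longrightarrow> norm (fderiv f (x + v) - fderiv f x) \<le> e"
    using deriv_unif[OF assms] by blast
  have "norm (fderiv f x - fderiv f y) \<le> e" if "norm (x - y) \<le> t" for x y
    using t(2)[of "x - y" y] that by simp
  then show ?thesis using t(1) that by blast
qed

lemma pseudotrajectory_deriv_close:
  assumes e: "0 < e"
  obtains d0 where "0 < d0"
    "\<And>d y j i. \<lbrakk>0 < d; d < d0; pseudotrajectory f d UNIV y; i \<le> n\<rbrakk> \<Longrightarrow>
      norm (fderiv f (y (j + int i)) - fderiv f ((f ^^ i) (y j))) \<le> e"
    "\<And>d y j i. \<lbrakk>0 < d; d < d0; pseudotrajectory f d UNIV y; i \<le> n\<rbrakk> \<Longrightarrow>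
      norm (fderiv f (y (j - int i)) - fderiv f ((inv f ^^ i) (y j))) \<le> e"
proof -
  obtain t where t: "0 < t" "\<And>x y. norm (x - y) \<le> t \<Longrightarrow> norm (fderiv f x - fderiv f y) \<le> e"
    using deriv_close[OF e] by blast
  \<comment> \<open>\<open>Z\<close> dominates the growth factors for all \<open>i \<le> n\<close>
    at once; the extra 1 keeps it positive when \<open>n = 0\<close>.\<close>
  define Z where "Z = (real n + 1) * (R + 1) ^ n"
  have Z: "0 < Z" using R_pos by (simp add: Z_def)
  have small: "d * (real i * (R + 1) ^ i) \<le> t" if "0 < d" "d < t / Z" "i \<le> n" for d i
  proof -
    have "real i * (R + 1) ^ i \<le> Z"
      unfolding Z_def using that R_pos by (intro mult_mono power_increasing) auto
    then have "d * (real i * (R + 1) ^ i) \<le> d * Z" using that by (intro mult_left_mono) auto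
    also have "\<dots> \<le> t" using that Z by (simp add: pos_less_divide_eq)
    finally show ?thesis .
  qed
  show ?thesis
  proof (rule that[of "t / Z"])
    show "0 < t / Z" using t Z by simp
    fix d y j i assume a: "0 < d" "d < t / Z" "pseudotrajectory f d UNIV y" "i \<le> n"
    show "norm (fderiv f (y (j + int i)) - fderiv f ((f ^^ i) (y j))) \<le> e"
      using pseudotrajectory_close(1)[OF a(3), of i j] small[OF a(1,2,4)] a(1)
      by (intro t(2)) (simp add: norm_minus_commute)
    show "norm (fderiv f (y (j - int i)) - fderiv f ((inv f ^^ i) (y j))) \<le> e"
      using pseudotrajectory_close(2)[OF a(3), of i j] small[OF a(1,2,4)] a(1)
      by (intro t(2)) (simp add: norm_minus_commute)
  qed
qed

text \<open>The mean value inequality is applied to \<open>f\<close> minus its linear part at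
  \<open>z\<close>, whose derivative is at most \<open>e\<close> on the ball. The bound is in terms
  of \<open>a - b\<close>, as a contraction estimate requires.\<close>

lemma linearization_error:
  assumes e: "\<And>x. norm (x - z) \<le> t \<Longrightarrow> norm (fderiv f x - fderiv f z) \<le> e"
    and "norm a \<le> t" "norm b \<le> t"
  shows "norm (f (z + a) - f (z + b) - fderiv f z (a - b)) \<le> e * norm (a - b)"
proof -
  have "norm ((\<lambda>x. f x - fderiv f z x) (z + a) - (\<lambda>x. f x - fderiv f z x) (z + b)) \<le> e * norm (z + a - (z + b))"
  proof (rule differentiable_bound[of "cball z t"])
    fix x assume x: "x \<in> cball z t"
    show "((\<lambda>x. f x - fderiv f z x) has_derivative blinfun_apply (fderiv f x - fderiv f z)) (at x within cball z t)"
      unfolding minus_blinfun.rep_eq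
      by (intro has_derivative_diff has_derivative_at_withinI[OF has_derivative_fderiv[OF diff(1)]]
          bounded_linear_imp_has_derivative blinfun.bounded_linear_right)
    show "onorm (blinfun_apply (fderiv f x - fderiv f z)) \<le> e"
      using e[of x] x by (simp add: norm_blinfun.rep_eq dist_norm norm_minus_commute)
  qed (use assms in \<open>auto simp: dist_norm\<close>)
  then show ?thesis by (simp add: blinfun.diff_right blinfun.add_right algebra_simps)
qed

lemma small_tail:
  assumes "lam < m" "0 < e"
  obtains n where "2 * H * (lam / m) ^ n \<le> e" "0 < n"
proof -
  have "(\<lambda>n. 2 * H * (lam / m) ^ n) \<longlonglongrightarrow> 2 * H * 0"
    using assms lam by (intro tendsto_mult tendsto_const LIMSEQ_realpow_zero) auto
  then have "\<forall>\<^sub>F n in sequentially. 2 * H * (lam / m) ^ n < e"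
    using assms by (intro order_tendstoD(2)) auto
  then obtain n where "2 * H * (lam / m) ^ n < e" "0 < n"
    unfolding eventually_sequentially by (metis le_add1 le_add2 add.commute zero_less_one less_le_trans)
  then show ?thesis by (rule that[OF less_imp_le])
qed

text \<open>The shadowing trajectory comes from a unique fixed point, so it can be chosen
  compatibly with shifts. Periodic shadowing and the semiconjugacy between a perturbation
  and \<open>f\<close> both rest on this compatibility.\<close>

lemma equivariant_shadowing:
  obtains M d0 where "0 < M" "0 < d0"
    "\<And>d. \<lbrakk>0 < d; d < d0\<rbrakk> \<Longrightarrow> \<exists>\<Phi>. \<forall>y. pseudotrajectory f d UNIV y \<longrightarrow>
      exact_trajectory f (\<Phi> y) \<and> (\<forall>k. norm (\<Phi> y k - y k) \<le> M * d) \<and>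
      (\<forall>m. \<Phi> (\<lambda>k. y (k + m)) = (\<lambda>k. \<Phi> y (k + m)))"
proof -
  obtain n where n: "2 * H * (lam / 1) ^ n \<le> 1 / 8" "0 < n"
    using small_tail[of 1 "1 / 8"] lam by auto
  define G where "G = 2 * real n * H"
  have G: "0 < G" using n H_pos by (simp add: G_def)
  \<comment> \<open>Three contributions of 1/8 each are arranged: the tails, the replacement of
    derivatives, and the nonlinear remainder. Together they stay below the contraction factor
    1/2.\<close>
  define e where "e = 1 / (8 * G)"
  have e: "0 < e" "e * G = 1 / 8" using G by (auto simp: e_def)
  obtain d1 where d1: "0 < d1"
    and fwd: "\<And>d y j i. \<lbrakk>0 < d; d < d1; pseudotrajectory f d UNIV y; i \<le> n\<rbrakk> \<Longrightarrow>
      norm (fderiv f (y (j + int i)) - fderiv f ((f ^^ i) (y j))) \<le> e"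
    and bwd: "\<And>d y j i. \<lbrakk>0 < d; d < d1; pseudotrajectory f d UNIV y; i \<le> n\<rbrakk> \<Longrightarrow>
      norm (fderiv f (y (j - int i)) - fderiv f ((inv f ^^ i) (y j))) \<le> e"
    using pseudotrajectory_deriv_close[OF e(1), of n] by blast
  obtain t where t: "0 < t" and close: "\<And>x y. norm (x - y) \<le> t \<Longrightarrow> norm (fderiv f x - fderiv f y) \<le> e"
    using deriv_close[OF e(1)] by blast
  \<comment> \<open>Inhomogeneities are sought in the ball of radius \<open>2 * d\<close>, so
    displacements are at most \<open>G * (2 * d) = M * d\<close>; the bound \<open>t / M\<close> on
    \<open>d\<close> keeps them where the linearization estimate holds.\<close>
  define M where "M = 2 * G"
  define d0 where "d0 = min d1 (t / M)"
  have M: "0 < M" using G by (simp add: M_def)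
  have d0: "0 < d0" using M t d1 by (simp add: d0_def)
  \<comment> \<open>The unknown is the inhomogeneity \<open>u\<close>, with displacement
    \<open>green n y u\<close>. A fixed point means exactly that \<open>y + green n y u\<close> is a
    trajectory, and by \<open>green_residual\<close> the linear part of \<open>T\<close> is
    small.\<close>
  define T where "T y u k = u k - (y k + green n y u k - f (y (k - 1) + green n y u (k - 1)))"
    for y u :: "int \<Rightarrow> 'b" and k
  have sw: "slow_weight 1 (\<lambda>_::int. 1)" by (rule slow_weight_const)
  have lam1: "lam \<le> 1" using lam by simp
  have gb: "norm (green n y u k) \<le> G * c" if "\<forall>k. norm (u k) \<le> c" for y u c k
    using green_bound[OF sw lam1, of u c n y k] that by (simp add: G_def)
  have ex: "\<exists>!u. (\<forall>k. norm (u k) \<le> 2 * d) \<and> T y u = u"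
    if d: "0 < d" "d < d0" and y: "pseudotrajectory f d UNIV y" for d y
  proof -
    have Md: "G * (2 * d) \<le> t" using d M by (simp add: d0_def M_def pos_less_divide_eq mult_ac)
    have contr: "norm (T y u k - T y v k) \<le> 1 / 2 * c"
      if c: "0 \<le> c" and u: "\<forall>k. norm (u k) \<le> 2 * d" and v: "\<forall>k. norm (v k) \<le> 2 * d"
        and uv: "\<forall>k. norm (u k - v k) \<le> c" for u v c k
    proof -
      define r where "r = (\<lambda>k. u k - v k)"
      define a b where "a = green n y u (k - 1)" and "b = green n y v (k - 1)"
      have "norm (r (k - 1 + 1) - green n y r (k - 1 + 1) + fderiv f (y (k - 1)) (green n y r (k - 1)))
          \<le> (2 * H * (lam / 1) ^ n + 2 * real n * H * e / 1) * (c * 1)"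
      proof (rule green_residual[OF sw lam1])
        have "d < d1" using d by (simp add: d0_def)
        then show "norm (fderiv f (y (j + int i)) - fderiv f ((f ^^ i) (y j))) \<le> e"
          "norm (fderiv f (y (j - int (Suc i))) - fderiv f ((inv f ^^ Suc i) (y j))) \<le> e" if "i < n" for i j
          using fwd[OF d(1) _ y, of i j] bwd[OF d(1) _ y, of "Suc i" j] that by (auto simp del: funpow.simps)
      qed (use e uv in \<open>auto simp: r_def\<close>)
      also have "\<dots> \<le> (1 / 8 + 1 / 8) * c"
        using n(1) e(2) c by (intro mult_mono) (auto simp: G_def mult_ac)
      finally have 1: "norm (r k - green n y r k + fderiv f (y (k - 1)) (green n y r (k - 1))) \<le> 1 / 4 * c"
        by simp
      have ab: "norm (a - b) \<le> G * c"
        using gb[of r c y "k - 1"] uv green_diff[of n y u v "k - 1"] by (simp add: r_def a_def b_def)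
      have "norm (f (y (k - 1) + a) - f (y (k - 1) + b) - fderiv f (y (k - 1)) (a - b)) \<le> e * norm (a - b)"
        by (rule linearization_error[of _ t])
          (use close order_trans[OF gb[OF u] Md] order_trans[OF gb[OF v] Md] in \<open>auto simp: a_def b_def\<close>)
      also have "\<dots> \<le> e * (G * c)" using ab e by (intro mult_left_mono) auto
      also have "\<dots> = 1 / 8 * c" using e(2) by (simp flip: mult.assoc)
      finally have 2: "norm (f (y (k - 1) + a) - f (y (k - 1) + b) - fderiv f (y (k - 1)) (a - b)) \<le> 1 / 8 * c" .
      have "T y u k - T y v k = (r k - green n y r k + fderiv f (y (k - 1)) (green n y r (k - 1)))
          + (f (y (k - 1) + a) - f (y (k - 1) + b) - fderiv f (y (k - 1)) (a - b))"
        by (simp add: T_def r_def green_diff a_def b_def algebra_simps)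
      then have "norm (T y u k - T y v k) \<le> 1 / 4 * c + 1 / 8 * c"
        using 1 2 norm_triangle_mono by metis
      then show ?thesis using c by simp
    qed
    have T0: "norm (T y (\<lambda>_. 0) k) \<le> d" for k
    proof -
      have "green n y (\<lambda>_. 0) k = 0" for k using gb[of "\<lambda>_. 0" 0 y k] by simp
      then show ?thesis
        using y unfolding pseudotrajectory_def T_def
        by simp (metis UNIV_I diff_add_cancel norm_minus_commute)
    qed
    \<comment> \<open>The image of zero has size at most \<open>d\<close>, and the contraction adds
      at most half the radius, so the ball of radius \<open>2 * d\<close> is mapped into
      itself.\<close>
    have "\<exists>!u. (\<forall>k. norm (u k) \<le> 2 * d * 1) \<and> T y u = u"
    proof (rule weighted_contraction_fixpoint[where q = "1 / 2"])
      fix u :: "int \<Rightarrow> 'b" assume u: "\<forall>k. norm (u k) \<le> 2 * d * 1"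
      have "norm (T y u k - T y (\<lambda>_. 0) k) \<le> 1 / 2 * (2 * d)" for k
        by (rule contr) (use u d in auto)
      then have "norm (T y u k) \<le> d + 1 / 2 * (2 * d)" for k
        using T0[of k] norm_triangle_sub[of "T y u k" "T y (\<lambda>_. 0) k"] by (meson add_mono order_trans)
      then have "norm (T y u k) \<le> 2 * d" for k by simp
      then show "\<forall>k. norm (T y u k) \<le> 2 * d * 1" by simp
    qed (use contr d in auto)
    then show ?thesis by simp
  qed
  have "\<exists>\<Phi>. \<forall>y. pseudotrajectory f d UNIV y \<longrightarrow>
      exact_trajectory f (\<Phi> y) \<and> (\<forall>k. norm (\<Phi> y k - y k) \<le> M * d) \<and>
      (\<forall>m. \<Phi> (\<lambda>k. y (k + m)) = (\<lambda>k. \<Phi> y (k + m)))" if d: "0 < d" "d < d0" for d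
  proof -
    \<comment> \<open>A unique description rather than an arbitrary choice: the shift of the
      solution for \<open>y\<close> solves the problem for the shifted \<open>y\<close>, hence is
      the selected one.\<close>
    define U where "U y = (THE u. (\<forall>k. norm (u k) \<le> 2 * d) \<and> T y u = u)" for y
    define \<Phi> where "\<Phi> y k = y k + green n y (U y) k" for y k
    have "exact_trajectory f (\<Phi> y) \<and> (\<forall>k. norm (\<Phi> y k - y k) \<le> M * d) \<and>
      (\<forall>m. \<Phi> (\<lambda>k. y (k + m)) = (\<lambda>k. \<Phi> y (k + m)))" if y: "pseudotrajectory f d UNIV y" for y
    proof (intro conjI allI)
      have U: "\<forall>k. norm (U y k) \<le> 2 * d" "T y (U y) = U y"
        using theI'[OF ex[OF d y]] by (auto simp: U_def)
      show "exact_trajectory f (\<Phi> y)"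
        unfolding exact_trajectory_def
      proof
        fix k
        have "T y (U y) (k + 1) = U y (k + 1)" using U by simp
        then show "\<Phi> y (k + 1) = f (\<Phi> y k)" by (simp add: T_def \<Phi>_def)
      qed
      show "norm (\<Phi> y k - y k) \<le> M * d" for k
        using gb[OF U(1), of y k] by (simp add: \<Phi>_def M_def)
      fix m
      define y' where "y' = (\<lambda>k. y (k + m))"
      have y': "pseudotrajectory f d UNIV y'"
        using y unfolding pseudotrajectory_def y'_def by (simp add: add_ac) (metis add.assoc add.commute)
      have "T y' (\<lambda>k. U y (k + m)) k = T y (U y) (k + m)" for k
        unfolding T_def y'_def green_shift by (simp add: algebra_simps)
      then have "T y' (\<lambda>k. U y (k + m)) = (\<lambda>k. U y (k + m))"
        unfolding U(2) by (rule ext)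
      then have "U y' = (\<lambda>k. U y (k + m))"
        unfolding U_def[of y'] using U(1) by (intro the1_equality[OF ex[OF d y']]) auto
      then show "\<Phi> (\<lambda>k. y (k + m)) = (\<lambda>k. \<Phi> y (k + m))"
        unfolding y'_def[symmetric] by (simp add: \<Phi>_def[abs_def]) (simp add: y'_def green_shift)
    qed
    then show ?thesis by blast
  qed
  then show ?thesis using that[OF M d0] by blast
qed

section \<open>Shadowing properties and chain recurrence\<close>

lemma Lipschitz_shadowing: "Lipschitz_shadowing f"
  unfolding Lipschitz_shadowing_def using equivariant_shadowing by metis

text \<open>A periodic \<open>y\<close> equals its own shift by \<open>N\<close>, so equivariance
  makes \<open>\<Phi> y\<close> equal to its shift by \<open>N\<close> as well.\<close>

lemma Lipschitz_periodic_shadowing: "Lipschitz_periodic_shadowing f"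
proof -
  obtain M d0 where M: "0 < M" "0 < d0"
    "\<And>d. \<lbrakk>0 < d; d < d0\<rbrakk> \<Longrightarrow> \<exists>\<Phi>. \<forall>y. pseudotrajectory f d UNIV y \<longrightarrow>
      exact_trajectory f (\<Phi> y) \<and> (\<forall>k. norm (\<Phi> y k - y k) \<le> M * d) \<and>
      (\<forall>m. \<Phi> (\<lambda>k. y (k + m)) = (\<lambda>k. \<Phi> y (k + m)))"
    using equivariant_shadowing by blast
  show ?thesis
    unfolding Lipschitz_periodic_shadowing_def
  proof (rule exI[of _ M], intro conjI exI[of _ d0] allI impI M(1,2))
    fix d y and N :: int
    assume a: "0 < N" "0 < d \<and> d < d0 \<and> pseudotrajectory f d UNIV y \<and> (\<forall>k. y (k + N) = y k)"
    then obtain \<Phi> where \<Phi>: "exact_trajectory f (\<Phi> y)" "\<forall>k. norm (\<Phi> y k - y k) \<le> M * d"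
      "\<forall>m. \<Phi> (\<lambda>k. y (k + m)) = (\<lambda>k. \<Phi> y (k + m))"
      using M(3)[of d] by blast
    have "(\<lambda>k. y (k + N)) = y" using a by auto
    then have "\<forall>k. \<Phi> y (k + N) = \<Phi> y k" using \<Phi>(3) by metis
    then show "\<exists>x. exact_trajectory f x \<and> (\<forall>k. x (k + N) = x k) \<and> (\<forall>k. norm (x k - y k) \<le> M * d)"
      using \<Phi> by blast
  qed
qed

lemma CR_subset_closure_Per: "CR f \<subseteq> closure (Per f)"
proof
  fix x assume x: "x \<in> CR f"
  obtain M d0 where M: "0 < M" "0 < d0" and shadow: "\<And>d y N. \<lbrakk>0 < N; 0 < d; d < d0; pseudotrajectory f d UNIV y;
      \<forall>k. y (k + N) = y k\<rbrakk> \<Longrightarrow>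
      \<exists>x. exact_trajectory f x \<and> (\<forall>k. x (k + N) = x k) \<and> (\<forall>k. norm (x k - y k) \<le> M * d)"
    using Lipschitz_periodic_shadowing unfolding Lipschitz_periodic_shadowing_def by (metis (no_types, opaque_lifting))
  show "x \<in> closure (Per f)"
    unfolding closure_approachable
  proof (intro allI impI)
    fix e :: real assume e: "0 < e"
    define d where "d = min (d0 / 2) (e / (2 * M))"
    have d: "0 < d" "d < d0" "d \<le> e / (2 * M)" using M e by (auto simp: d_def)
    then have Md: "M * d < e" using M e by (simp add: pos_le_divide_eq mult_ac)
    obtain N y where N: "1 \<le> N" and y: "pseudotrajectory f d {0..N} y" "y 0 = x" "y N = x"
      using x d(1) unfolding CR_def by blast
    \<comment> \<open>The closed chain is repeated periodically. At the wrap-around the value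
      \<open>y N\<close> is replaced by \<open>y 0\<close>, which is the same point
      \<open>x\<close>.\<close>
    define z where "z k = y (k mod N)" for k
    have "pseudotrajectory f d UNIV z"
      unfolding pseudotrajectory_def
    proof (intro allI impI)
      fix k
      have r: "0 \<le> k mod N" "k mod N < N" using N by auto
      have "z (k + 1) = y (k mod N + 1)"
      proof (cases "k mod N + 1 = N")
        case True
        then have "(k + 1) mod N = 0" by (metis mod_add_left_eq mod_self)
        then show ?thesis using True y by (simp add: z_def)
      next
        case False
        then have "(k + 1) mod N = k mod N + 1"
          using r mod_pos_pos_trivial[of "k mod N + 1" N] mod_add_left_eq[of k N 1] by auto
        then show ?thesis by (simp add: z_def)
      qed
      then show "norm (z (k + 1) - f (z k)) \<le> d"
        using y(1) r unfolding pseudotrajectory_def z_def by simp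
    qed
    moreover have "\<forall>k. z (k + N) = z k" by (simp add: z_def)
    ultimately obtain p where p: "exact_trajectory f p" "\<forall>k. p (k + N) = p k" "\<forall>k. norm (p k - z k) \<le> M * d"
      using shadow[of N d z] N d by auto
    have "(f ^^ nat N) (p 0) = p 0"
      using exact_trajectory_iterate(1)[OF bij_f p(1), of "nat N" 0] p(2)[rule_format, of 0] N by simp
    then have "p 0 \<in> Per f" using N unfolding Per_def by (intro CollectI exI[of _ "nat N"]) auto
    moreover have "dist (p 0) x < e"
      using p(3)[rule_format, of 0] Md y by (simp add: z_def dist_norm)
    ultimately show "\<exists>p\<in>Per f. dist p x < e" by blast
  qed
qed

lemma closure_Per_subset_CR: "closure (Per f) \<subseteq> CR f"
proof
  fix x assume x: "x \<in> closure (Per f)"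
  show "x \<in> CR f"
    unfolding CR_def
  proof (intro CollectI allI impI)
    fix d :: real assume d: "0 < d"
    have "isCont f x" using diff(1) by (rule differentiable_imp_continuous_within)
    then obtain t where t: "0 < t" "\<And>p. dist p x < t \<Longrightarrow> dist (f p) (f x) < d"
      using d unfolding continuous_at_eps_delta by blast
    obtain p where p: "p \<in> Per f" "dist p x < min t d"
      using x t d unfolding closure_approachable by (metis min_less_iff_conj)
    then obtain n where n: "0 < n" "(f ^^ n) p = p" unfolding Per_def by blast
    \<comment> \<open>Running the periodic orbit twice makes the first and the last jump distinct
      even for a fixed point. Both ends are then replaced by \<open>x\<close>: the first jump is
      controlled by continuity of \<open>f\<close> at \<open>x\<close>, the last by the distance
      from \<open>p\<close> to \<open>x\<close>.\<close>
    define N where "N = int (n + n)"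
    have "nat N = n + n" by (simp add: N_def)
    then have N: "2 \<le> N" "(f ^^ nat N) p = p" using n by (auto simp: N_def funpow_add)
    define y where "y k = (if k = 0 \<or> k = N then x else (f ^^ nat k) p)" for k
    have "norm (y (k + 1) - f (y k)) \<le> d" if k: "0 \<le> k" "k + 1 \<le> N" for k
    proof -
      have Suc: "(f ^^ nat (k + 1)) p = f ((f ^^ nat k) p)" using k by (simp add: nat_add_distrib)
      consider "k = 0" | "k \<noteq> 0" "k + 1 = N" | "k \<noteq> 0" "k + 1 \<noteq> N" by blast
      then show ?thesis
      proof cases
        case 1
        then show ?thesis using N t(2)[of p] p(2) by (simp add: y_def dist_norm)
      next
        case 2
        then have "f ((f ^^ nat k) p) = p" using N Suc by simp
        then show ?thesis using 2 p(2) k by (simp add: y_def dist_norm norm_minus_commute)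
      next
        case 3
        then show ?thesis using Suc k d by (simp add: y_def)
      qed
    qed
    then have "pseudotrajectory f d {0..N} y" by (simp add: pseudotrajectory_def)
    moreover have "y 0 = x" "y N = x" by (auto simp: y_def)
    ultimately show "\<exists>N\<ge>1. \<exists>y. pseudotrajectory f d {0..N} y \<and> y 0 = x \<and> y N = x"
      using N(1) by (intro exI[of _ N]) auto
  qed
qed

section \<open>Robustness\<close>

text \<open>The space \<open>W = E\<^sup>s \<oplus> Df\<inverse> E\<^sup>u\<close>, in general a proper subspace because \<open>Df\<close> need not map
  \<open>E\<^sup>u\<close> into \<open>E\<^sup>u\<close>.\<close>

definition local_range :: "'b \<Rightarrow> 'b set" where
  "local_range x = {v. P (f x) (fderiv f x (Q x v)) = 0}"

lemma local_range_0: "0 \<in> local_range x"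
  by (simp add: local_range_def)

lemma local_range_diff: "u \<in> local_range x \<Longrightarrow> v \<in> local_range x \<Longrightarrow> u - v \<in> local_range x"
  by (simp add: local_range_def blinfun.diff_right)

lemma local_range_lincomb:
  "u \<in> local_range x \<Longrightarrow> v \<in> local_range x \<Longrightarrow> a *\<^sub>R u + b *\<^sub>R v \<in> local_range x"
  by (simp add: local_range_def blinfun.add_right blinfun.scaleR_right)

section \<open>The linearized equation along an exact trajectory of \<open>f\<close>\<close>

lemma P_fderiv_P: "P (f x) (fderiv f x (P x v)) = fderiv f x (P x v)"
  using P_invariant[of x] by (metis P_P image_subset_iff rangeE rangeI)

lemma Q_fderiv_inv_Q: "Q (inv f x) (fderiv (inv f) x (Q x v)) = fderiv (inv f) x (Q x v)"
  using Q_invariant[of x] by (metis Q_Q image_subset_iff rangeE rangeI)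

lemma P_Fw: "P ((f ^^ i) x) (Fw i x v) = Fw i x v"
proof (induction i)
  case 0 then show ?case by (simp add: Fw_0)
next
  case (Suc i)
  have "Fw (Suc i) x v = fderiv f ((f ^^ i) x) (P ((f ^^ i) x) (Fw i x v))"
    using Suc by (simp add: Fw_Suc)
  then show ?case by (simp add: P_fderiv_P)
qed

lemma Q_Bw: "Q ((inv f ^^ i) x) (Bw i x v) = Bw i x v"
proof (induction i)
  case 0 then show ?case by (simp add: Bw_0)
next
  case (Suc i)
  have "Bw (Suc i) x v = fderiv (inv f) ((inv f ^^ i) x) (Bw i x v)"
    unfolding Bw_def by (rule fderiv_funpow_Suc(1)[OF diff(2)])
  also have "\<dots> = fderiv (inv f) ((inv f ^^ i) x) (Q ((inv f ^^ i) x) (Bw i x v))"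
    using Suc by simp
  finally show ?case by (simp add: Q_fderiv_inv_Q)
qed

text \<open>Along an exact trajectory the forward terms are stable at \<open>y k\<close>. The
  backward sum starts one step ahead of \<open>k\<close>, so its terms are unstable at
  \<open>y k\<close> and remain unstable after one application of the derivative.\<close>

lemma green_in_local_range:
  assumes y: "exact_trajectory f y"
  shows "green n y u k \<in> local_range (y k)"
proof -
  have F: "Q (y k) (Fw i (y (k - int i)) v) = 0" for i v
    using P_Fw[of i "y (k - int i)" v] exact_trajectory_iterate(1)[OF bij_f y, of i "k - int i"]
      Q_P[of "y k" "Fw i (y (k - int i)) v"] by simp
  have G: "P (f (y k)) (fderiv f (y k) (Q (y k) (Bw (Suc i) (y (k + 1 + int i)) v))) = 0" for i v
  proof -
    have 1: "(inv f ^^ Suc i) (y (k + 1 + int i)) = y k" "(inv f ^^ i) (y (k + 1 + int i)) = y (k + 1)"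
      using exact_trajectory_iterate(2)[OF bij_f y, of "Suc i" "k + 1 + int i"]
        exact_trajectory_iterate(2)[OF bij_f y, of i "k + 1 + int i"] by (auto simp del: funpow.simps)
    have "fderiv f (y k) (Q (y k) (Bw (Suc i) (y (k + 1 + int i)) v)) = Bw i (y (k + 1 + int i)) v"
      using Q_Bw[of "Suc i" "y (k + 1 + int i)" v] Bw_Suc[of i "y (k + 1 + int i)" v] unfolding 1 by simp
    also have "\<dots> = Q (f (y k)) (Bw i (y (k + 1 + int i)) v)"
      using Q_Bw[of i "y (k + 1 + int i)" v] y unfolding 1 exact_trajectory_def by simp
    finally show ?thesis by simp
  qed
  show ?thesis
    unfolding local_range_def green_def
    by (simp add: blinfun.diff_right blinfun.minus_right blinfun.sum_right F G del: of_nat_Suc)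
qed

text \<open>In this class the derivative commutes with the projections along \<open>v\<close>, so
  the equation decouples. The stable component is unrolled \<open>n\<close> steps into the past, the
  unstable one \<open>n\<close> steps into the future. This a priori formula drives
  uniqueness.\<close>

lemma green_representation:
  assumes y: "exact_trajectory f y" and v: "\<And>k. v k \<in> local_range (y k)"
    and e: "\<And>k. e (k + 1) = v (k + 1) - fderiv f (y k) (v k)"
  shows "v k = green n y e k + Fw n (y (k - int n)) (v (k - int n)) + Bw n (y (k + int n)) (v (k + int n))"
proof -
  have y1: "y (k + 1) = f (y k)" for k using y by (simp add: exact_trajectory_def)
  have split: "P (y (k + 1)) (fderiv f (y k) (v k)) = fderiv f (y k) (P (y k) (v k))"
    "Q (y (k + 1)) (fderiv f (y k) (v k)) = fderiv f (y k) (Q (y k) (v k))" for k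
  proof -
    have "fderiv f (y k) (v k) = fderiv f (y k) (P (y k) (v k)) + fderiv f (y k) (Q (y k) (v k))"
      by (metis splitting blinfun.add_right)
    moreover have "P (y (k + 1)) (fderiv f (y k) (Q (y k) (v k))) = 0"
      using v[of k] by (simp add: local_range_def y1)
    ultimately show 1: "P (y (k + 1)) (fderiv f (y k) (v k)) = fderiv f (y k) (P (y k) (v k))"
      by (simp add: blinfun.add_right P_fderiv_P y1)
    then show "Q (y (k + 1)) (fderiv f (y k) (v k)) = fderiv f (y k) (Q (y k) (v k))"
      by (metis splitting blinfun.add_right add_left_cancel)
  qed
  have Pv: "P (y k) (v k) = (\<Sum>i<n. Fw i (y (k - int i)) (e (k - int i))) + Fw n (y (k - int n)) (v (k - int n))" for n
  proof (induction n)
    case 0 then show ?case by (simp add: Fw_0)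
  next
    case (Suc n)
    define j where "j = k - int (Suc n)"
    have j: "k - int n = j + 1" by (simp add: j_def)
    have "Fw (Suc n) (y j) (v j) = fderiv (f ^^ n) (y (j + 1)) (fderiv f (y j) (P (y j) (v j)))"
      unfolding Fw_def y1 by (rule fderiv_funpow_Suc(2)[OF diff(1)])
    also have "\<dots> = Fw n (y (j + 1)) (fderiv f (y j) (v j))"
      by (simp add: Fw_def split)
    finally have "Fw n (y (j + 1)) (v (j + 1)) = Fw n (y (j + 1)) (e (j + 1)) + Fw (Suc n) (y j) (v j)"
      by (simp add: e Fw_linear)
    then show ?case using Suc unfolding j_def[symmetric] sum.lessThan_Suc j by simp
  qed
  have Qv: "Q (y k) (v k) = Bw n (y (k + int n)) (v (k + int n)) - (\<Sum>i<n. Bw (Suc i) (y (k + 1 + int i)) (e (k + 1 + int i)))" for n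
  proof (induction n)
    case 0 then show ?case by (simp add: Bw_0)
  next
    case (Suc n)
    define j where "j = k + int n"
    have j: "k + int (Suc n) = j + 1" "k + 1 + int n = j + 1" by (auto simp: j_def)
    have "Bw (Suc n) (y (j + 1)) (fderiv f (y j) (v j))
      = fderiv (inv f ^^ n) (inv f (y (j + 1))) (fderiv (inv f) (y (j + 1)) (fderiv f (y j) (Q (y j) (v j))))"
      unfolding Bw_def split by (rule fderiv_funpow_Suc(2)[OF diff(2)])
    also have "\<dots> = Bw n (y j) (v j)"
      by (simp add: y1 fderiv_inv_apply(1)[OF diffeo] Bw_def)
    finally have "Bw n (y j) (v j) = Bw (Suc n) (y (j + 1)) (v (j + 1)) - Bw (Suc n) (y (j + 1)) (e (j + 1))"
      by (simp add: e Bw_linear)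
    then show ?case using Suc unfolding sum.lessThan_Suc j by (simp add: j_def)
  qed
  show ?thesis
    using splitting[of "y k" "v k"] unfolding Pv[of n] Qv[of n] green_def
    by (simp add: algebra_simps)
qed

section \<open>Bounded solutions of a perturbed linear cocycle\<close>

lemma perturbed_cocycle:
  assumes m: "lam < m" "m \<le> 1"
  obtains e C1 where "0 < e" "0 < C1"
    "\<And>y B w. \<lbrakk>exact_trajectory f y; \<And>k. norm (B k - fderiv f (y k)) \<le> e\<rbrakk> \<Longrightarrow>
      \<exists>v. (\<forall>k. v k \<in> local_range (y k)) \<and>
        (\<forall>k. v (k + 1) = blinfun_apply (B k) (v k) + (if k + 1 = 0 then w else 0)) \<and>
        (\<forall>k. norm (v k) \<le> C1 * norm w * m ^ nat \<bar>k\<bar>)"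
    "\<And>y B v b k. \<lbrakk>exact_trajectory f y; \<And>k. norm (B k - fderiv f (y k)) \<le> e; \<And>k. v k \<in> local_range (y k);
      \<And>k. v (k + 1) = blinfun_apply (B k) (v k); \<And>k. norm (v k) \<le> b\<rbrakk> \<Longrightarrow> v k = 0"
proof -
  obtain n where n: "2 * H * (lam / m) ^ n \<le> 1 / 4" "0 < n"
    using small_tail[OF m(1), of "1 / 4"] by auto
  define G where "G = 2 * real n * H"
  have G: "0 < G" using n H_pos by (simp add: G_def)
  \<comment> \<open>This gives 1/4 for the weighted replacement error \<open>G * e / m\<close>,
    making the contraction factor 1/2 together with the tails. It also gives
    \<open>G * e = m / 4\<close>, at most 1/4, for the unweighted uniqueness estimate.\<close>
  define e where "e = m / (4 * G)"
  have m0: "0 < m" using m lam by simp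
  have e: "0 < e" "G * e / m = 1 / 4" "G * e = m / 4" using G m0 by (auto simp: e_def)
  define W where "W k = m ^ nat \<bar>k\<bar>" for k :: int
  have sw: "slow_weight m W" unfolding W_def by (rule slow_weight_power[OF m0 m(2)])
  have lm: "lam \<le> m" using m by simp
  have W0: "0 < W k" for k using m0 by (simp add: W_def)
  have exists: "\<exists>v. (\<forall>k. v k \<in> local_range (y k)) \<and>
        (\<forall>k. v (k + 1) = blinfun_apply (B k) (v k) + (if k + 1 = 0 then w else 0)) \<and>
        (\<forall>k. norm (v k) \<le> 2 * G * norm w * m ^ nat \<bar>k\<bar>)"
    if y: "exact_trajectory f y" and B: "\<And>k. norm (B k - fderiv f (y k)) \<le> e" for y B w
  proof -
    define \<delta> where "\<delta> k = (if k = 0 then w else 0)" for k :: int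
    \<comment> \<open>A fixed point says that \<open>green n y u\<close> solves the perturbed
      equation with source \<open>w\<close> at time 0. It then lies in the local ranges
      automatically and inherits the decay of the weight.\<close>
    define T where "T u k = u k - green n y u k + B (k - 1) (green n y u (k - 1)) + \<delta> k"
      for u :: "int \<Rightarrow> 'b" and k
    have contr: "norm (T u k - T v k) \<le> 1 / 2 * c * W k"
      if uv: "\<forall>k. norm (u k - v k) \<le> c * W k" for u v c k
    proof -
      define r where "r = (\<lambda>k. u k - v k)"
      have "norm (r (k - 1 + 1) - green n y r (k - 1 + 1) + B (k - 1) (green n y r (k - 1)))
          \<le> (2 * H * (lam / m) ^ n + 2 * real n * H * e / m) * (c * W (k - 1 + 1))"
      proof (rule green_residual[OF sw lm])
        show "norm (B (j + int i) - fderiv f ((f ^^ i) (y j))) \<le> e"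
          "norm (B (j - int (Suc i)) - fderiv f ((inv f ^^ Suc i) (y j))) \<le> e" for i j
          unfolding exact_trajectory_iterate[OF bij_f y] by (rule B)+
      qed (use e uv in \<open>auto simp: r_def\<close>)
      also have "\<dots> \<le> (1 / 4 + 1 / 4) * (c * W (k - 1 + 1))"
        using n(1) e(2) uv[rule_format, of k] order_trans[OF norm_ge_zero]
        by (intro mult_right_mono add_mono) (auto simp: G_def)
      finally have "norm (r k - green n y r k + B (k - 1) (green n y r (k - 1))) \<le> 1 / 2 * c * W k" by simp
      moreover have "T u k - T v k = r k - green n y r k + B (k - 1) (green n y r (k - 1))"
        by (simp add: T_def r_def green_diff blinfun.diff_right algebra_simps)
      ultimately show ?thesis by simp
    qed
    have T0: "norm (T (\<lambda>_. 0) k) \<le> norm w * W k" for k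
    proof -
      have "green n y (\<lambda>_. 0) k = 0" for k
        using green_bound[OF sw lm, of "\<lambda>_. 0" 0 n y k] by simp
      then show ?thesis using W0[of k] by (auto simp: T_def \<delta>_def W_def)
    qed
    have "\<exists>!u. (\<forall>k. norm (u k) \<le> 2 * norm w * W k) \<and> T u = u"
    proof (rule weighted_contraction_fixpoint[where q = "1 / 2"])
      fix u :: "int \<Rightarrow> 'b" assume u: "\<forall>k. norm (u k) \<le> 2 * norm w * W k"
      have "norm (T u k - T (\<lambda>_. 0) k) \<le> 1 / 2 * (2 * norm w) * W k" for k
        by (rule contr) (use u in auto)
      then have "norm (T u k) \<le> norm w * W k + 1 / 2 * (2 * norm w) * W k" for k
        using T0[of k] norm_triangle_sub[of "T u k" "T (\<lambda>_. 0) k"] by (meson add_mono order_trans)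
      then show "\<forall>k. norm (T u k) \<le> 2 * norm w * W k" by (simp add: algebra_simps)
    qed (use contr W0 in auto)
    then obtain u where u: "\<And>k. norm (u k) \<le> 2 * norm w * W k" "T u = u" by auto
    show ?thesis
    proof (rule exI[of _ "green n y u"], intro conjI allI)
      fix k
      show "green n y u k \<in> local_range (y k)" by (rule green_in_local_range[OF y])
      have "T u (k + 1) = u (k + 1)" using u by simp
      then show "green n y u (k + 1) = B k (green n y u k) + (if k + 1 = 0 then w else 0)"
        by (simp add: T_def \<delta>_def algebra_simps split: if_splits)
      show "norm (green n y u k) \<le> 2 * G * norm w * m ^ nat \<bar>k\<bar>"
        using green_bound[OF sw lm u(1), of n y k] by (simp add: G_def W_def mult_ac)
    qed
  qed
  have unique: "v k = 0"
    if y: "exact_trajectory f y" and B: "\<And>k. norm (B k - fderiv f (y k)) \<le> e"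
      and v: "\<And>k. v k \<in> local_range (y k)" "\<And>k. v (k + 1) = blinfun_apply (B k) (v k)" "\<And>k. norm (v k) \<le> b"
    for y B v b k
  proof -
    define s where "s = (SUP k. norm (v k))"
    have bdd: "bdd_above (range (\<lambda>k. norm (v k)))" using v(3) by (intro bdd_aboveI[of _ b]) auto
    have s: "norm (v k) \<le> s" for k unfolding s_def by (rule cSUP_upper[OF _ bdd]) simp
    have s0: "0 \<le> s" using s[of 0] norm_ge_zero order_trans by blast
    have sw1: "slow_weight 1 (\<lambda>_::int. 1)" by (rule slow_weight_const)
    have lam1: "lam \<le> 1" using lam by simp
    \<comment> \<open>A homogeneous solution for \<open>B\<close> is an inhomogeneous one for the
      derivative of \<open>f\<close> with this small right-hand side. The representation formula
      then bounds \<open>v\<close> by 1/4 + 1/8 + 1/8 of its own supremum \<open>s\<close>.\<close>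
    define r where "r k = (B (k - 1) - fderiv f (y (k - 1))) (v (k - 1))" for k
    have r: "norm (r k) \<le> e * s * 1" for k
      unfolding r_def
      by (rule order_trans[OF norm_blinfun]) (use mult_mono[OF B s] e(1) in simp)
    have rv: "r (k + 1) = v (k + 1) - fderiv f (y k) (v k)" for k
      by (simp add: r_def v(2) minus_blinfun.rep_eq)
    have "lam \<le> lam / m" using m0 m lam by (simp add: pos_le_divide_eq mult_left_le)
    then have "2 * H * lam ^ n \<le> 2 * H * (lam / m) ^ n"
      using H_pos lam by (intro mult_left_mono power_mono) auto
    then have Hn: "H * lam ^ n \<le> 1 / 8" using n(1) by simp
    have "norm (v k) \<le> s / 2" for k
    proof -
      have 1: "norm (green n y r k) \<le> 1 / 4 * s"
      proof -
        have "norm (green n y r k) \<le> 2 * real n * H * (e * s * 1)"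
          by (rule green_bound[OF sw1 lam1 r])
        also have "\<dots> = m / 4 * s" using e(3) by (simp add: G_def mult_ac)
        also have "\<dots> \<le> 1 / 4 * s" using m s0 by (intro mult_right_mono) auto
        finally show ?thesis .
      qed
      have 2: "H * lam ^ n * norm (v j) \<le> 1 / 8 * s" for j
        using Hn s[of j] by (intro mult_mono) auto
      have "norm (v k) \<le> norm (green n y r k) + norm (Fw n (y (k - int n)) (v (k - int n)))
          + norm (Bw n (y (k + int n)) (v (k + int n)))"
        using norm_triangle_ineq[of "green n y r k + Fw n (y (k - int n)) (v (k - int n))"]
          norm_triangle_ineq[of "green n y r k" "Fw n (y (k - int n)) (v (k - int n))"]
        by (smt (verit) green_representation[OF y v(1) rv, of k n])
      then show ?thesis
        using 1 order_trans[OF Fw_bound 2, of "y (k - int n)" "k - int n"]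
          order_trans[OF Bw_bound 2, of "y (k + int n)" "k + int n"] by linarith
    qed
    then have "s \<le> s / 2" unfolding s_def by (intro cSUP_least) (auto simp: s_def)
    then show "v k = 0" using s[of k] norm_le_zero_iff[of "v k"] by linarith
  qed
  show ?thesis
  proof (rule that[of e "2 * G"])
    show "0 < e" "0 < 2 * G" using e(1) G by simp_all
  qed (fact exists, fact unique)
qed

section \<open>Invariant splitting for a perturbation, read off from bounded solutions\<close>

lemma perturbed_splitting:
  fixes g :: "'b \<Rightarrow> 'b" and Y :: "'b \<Rightarrow> int \<Rightarrow> 'b"
  assumes m: "0 < m" "m < 1" and C1: "0 < C1" and g: "C1_diffeo g"
    and Y_shift: "\<And>x k. Y (g x) k = Y x (k + 1)"
    and exists: "\<And>x w. \<exists>v. (\<forall>k. v k \<in> local_range (Y x k)) \<and>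
        (\<forall>k. v (k + 1) = fderiv g (orbit g x k) (v k) + (if k + 1 = 0 then w else 0)) \<and>
        (\<forall>k. norm (v k) \<le> C1 * norm w * m ^ nat \<bar>k\<bar>)"
    and unique: "\<And>x v b k. \<lbrakk>\<And>k. v k \<in> local_range (Y x k);
      \<And>k. v (k + 1) = fderiv g (orbit g x k) (v k); \<And>k. norm (v k) \<le> b\<rbrakk> \<Longrightarrow> v k = 0"
  shows "generalized_hyperbolic_with g (C1 + 1) m"
proof -
  note bij = C1_diffeoD(1)[OF g]
  note dg = C1_diffeoD(2,3)[OF g]
  note orb1 = exact_trajectory_orbit[OF bij, unfolded exact_trajectory_def, rule_format]
  define B where "B x k = fderiv g (orbit g x k)" for x k
  define Sol where "Sol x w v \<longleftrightarrow> (\<exists>b. \<forall>k. norm (v k) \<le> b) \<and> (\<forall>k. v k \<in> local_range (Y x k)) \<and>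
    (\<forall>k. v (k + 1) = B x k (v k) + (if k + 1 = 0 then w else 0))" for x w and v :: "int \<Rightarrow> 'b"
  have Sol_unique: "u = v" if sol: "Sol x w u" "Sol x w v" for x w u v
  proof
    fix k
    obtain a b where ab: "\<forall>k. norm (u k) \<le> a" "\<forall>k. norm (v k) \<le> b"
      using sol unfolding Sol_def by blast
    have "u k - v k = 0"
    proof (rule unique[of "\<lambda>k. u k - v k" x "a + b"])
      show "norm (u k - v k) \<le> a + b" for k
        using ab norm_triangle_ineq4[of "u k" "v k"] by (meson add_mono order_trans)
    qed (use sol in \<open>auto simp: Sol_def B_def blinfun.diff_right intro: local_range_diff\<close>)
    then show "u k = v k" by simp
  qed
  have Sol_ex: "\<exists>v. Sol x w v \<and> (\<forall>k. norm (v k) \<le> C1 * norm w * m ^ nat \<bar>k\<bar>)" for x w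
  proof -
    obtain v where v: "\<forall>k. v k \<in> local_range (Y x k)"
        "\<forall>k. v (k + 1) = fderiv g (orbit g x k) (v k) + (if k + 1 = 0 then w else 0)"
        "\<forall>k. norm (v k) \<le> C1 * norm w * m ^ nat \<bar>k\<bar>"
      using exists by metis
    have "C1 * norm w * m ^ nat \<bar>k\<bar> \<le> C1 * norm w * 1" for k
      using m C1 by (intro mult_left_mono power_le_one) auto
    then have "\<forall>k. norm (v k) \<le> C1 * norm w * 1" using v(3) order_trans by blast
    then show ?thesis using v unfolding Sol_def B_def by blast
  qed
  define V where "V x w = (THE v. Sol x w v)" for x w
  have V_eqI: "V x w = v" if "Sol x w v" for x w v
    unfolding V_def using that Sol_unique by blast
  have V: "Sol x w (V x w)" and V_bound: "norm (V x w k) \<le> C1 * norm w * m ^ nat \<bar>k\<bar>" for x w k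
    using Sol_ex[of x w] V_eqI by metis+
  have V_step: "V x w (k + 1) = B x k (V x w k) + (if k + 1 = 0 then w else 0)"
    and V_range: "V x w k \<in> local_range (Y x k)" for x w k
    using V by (auto simp: Sol_def)
  have V_lincomb: "V x (a *\<^sub>R u + b *\<^sub>R v) = (\<lambda>k. a *\<^sub>R V x u k + b *\<^sub>R V x v k)" for x a b u v
  proof (rule V_eqI)
    obtain c d where cd: "\<forall>k. norm (V x u k) \<le> c" "\<forall>k. norm (V x v k) \<le> d"
      using V by (metis Sol_def)
    have "norm (a *\<^sub>R V x u k + b *\<^sub>R V x v k) \<le> \<bar>a\<bar> * c + \<bar>b\<bar> * d" for k
      by (rule order_trans[OF norm_triangle_ineq]) (use cd in \<open>auto intro!: add_mono mult_left_mono\<close>)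
    moreover have "a *\<^sub>R V x u (k + 1) + b *\<^sub>R V x v (k + 1) = B x k (a *\<^sub>R V x u k + b *\<^sub>R V x v k)
        + (if k + 1 = 0 then a *\<^sub>R u + b *\<^sub>R v else 0)" for k
      unfolding V_step by (simp add: blinfun.add_right blinfun.scaleR_right algebra_simps)
    ultimately show "Sol x (a *\<^sub>R u + b *\<^sub>R v) (\<lambda>k. a *\<^sub>R V x u k + b *\<^sub>R V x v k)"
      unfolding Sol_def using local_range_lincomb[OF V_range V_range] by blast
  qed
  define P' where "P' x = Blinfun (\<lambda>w. V x w 0)" for x
  have "bounded_linear (\<lambda>w. V x w 0)" for x
  proof (rule bounded_linear_intro[of _ C1])
    show "V x (u + v) 0 = V x u 0 + V x v 0" for u v
      using V_lincomb[of x 1 u 1 v] by simp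
    show "V x (a *\<^sub>R u) 0 = a *\<^sub>R V x u 0" for a u
      using V_lincomb[of x a u 0 0] by simp
    show "norm (V x u 0) \<le> norm u * C1" for u
      using V_bound[of x u 0] by (simp add: mult.commute)
  qed
  then have P'[simp]: "blinfun_apply (P' x) w = V x w 0" for x w
    by (simp add: P'_def bounded_linear_Blinfun_apply)
  define Q' where "Q' x = id_blinfun - P' x" for x
  have Q'[simp]: "blinfun_apply (Q' x) w = w - V x w 0" for x w
    by (simp add: Q'_def minus_blinfun.rep_eq)
  have P'_norm: "norm (P' x) \<le> C1" for x
    using V_bound[of x _ 0] C1 by (intro norm_blinfun_bound) auto
  have Q'_norm: "norm (Q' x) \<le> C1 + 1" for x
    using P'_norm[of x] norm_triangle_ineq4[of id_blinfun "P' x"] norm_blinfun_id_le[where 'a = 'b]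
    by (auto simp: Q'_def)
  have orb_g: "orbit g (g x) k = orbit g x (k + 1)" for x k
    using fun_cong[OF orbit_shift[OF bij, of x 1], of k] by (simp add: orbit_def)
  have bounded: "\<exists>b. \<forall>k. norm (V x w k) \<le> b" for x w
    using V by (simp add: Sol_def)
  have idem: "V x (V x w 0) 0 = V x w 0" for x w
  proof -
    obtain b where b: "\<forall>k. norm (V x w k) \<le> b" using bounded by blast
    then have b0: "0 \<le> b" using norm_ge_zero order_trans by blast
    \<comment> \<open>Erasing the past keeps all conditions, because zero lies in every local range;
      the jump at time 0 becomes \<open>V x w 0\<close>, which is therefore its own
      projection.\<close>
    have "Sol x (V x w 0) (\<lambda>k. if 0 \<le> k then V x w k else 0)"
      unfolding Sol_def
    proof (intro conjI allI)
      show "\<exists>b. \<forall>k. norm (if 0 \<le> k then V x w k else 0) \<le> b"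
        using b b0 by (intro exI[of _ b]) auto
      show "(if 0 \<le> k then V x w k else 0) \<in> local_range (Y x k)" for k
        by (simp add: V_range local_range_0)
      show "(if 0 \<le> k + 1 then V x w (k + 1) else 0)
        = B x k (if 0 \<le> k then V x w k else 0) + (if k + 1 = 0 then V x w 0 else 0)" for k
        using V_step[of x w k] by (cases "k + 1 = 0") auto
    qed
    from V_eqI[OF this] show ?thesis by simp
  qed
  have P'_inv: "V (g x) (fderiv g x (V x w 0)) 0 = fderiv g x (V x w 0)" for x w
  proof -
    obtain b where b: "\<forall>k. norm (V x w k) \<le> b" using bounded by blast
    then have b0: "0 \<le> b" using norm_ge_zero order_trans by blast
    have V1: "V x w 1 = fderiv g x (V x w 0)"
      using V_step[of x w 0] by (simp add: B_def orbit_def)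
    \<comment> \<open>The future from time 1 on, seen from \<open>g x\<close>: its initial value and
      its source coincide, so the derivative maps stable vectors to stable vectors.\<close>
    have "Sol (g x) (fderiv g x (V x w 0)) (\<lambda>k. if 0 \<le> k then V x w (k + 1) else 0)"
      unfolding Sol_def
    proof (intro conjI allI)
      show "\<exists>b. \<forall>k. norm (if 0 \<le> k then V x w (k + 1) else 0) \<le> b"
        using b b0 by (intro exI[of _ b]) auto
      show "(if 0 \<le> k then V x w (k + 1) else 0) \<in> local_range (Y (g x) k)" for k
        by (simp add: V_range local_range_0 Y_shift)
      show "(if 0 \<le> k + 1 then V x w (k + 1 + 1) else 0)
        = B (g x) k (if 0 \<le> k then V x w (k + 1) else 0) + (if k + 1 = 0 then fderiv g x (V x w 0) else 0)" for k
        using V_step[of x w "k + 1"] V1 by (cases "k + 1 = 0") (auto simp: B_def orb_g)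
    qed
    from V_eqI[OF this] V1 show ?thesis by simp
  qed
  \<comment> \<open>The source acts on the step from time -1 to time 0, so the complementary part of
    \<open>w\<close> is, up to sign, the image of the vector just before the jump and has a bounded
    past.\<close>
  have V_minus1: "w - V x w 0 = - fderiv g (inv g x) (V x w (- 1))" for x w
    using V_step[of x w "- 1"] by (simp add: B_def orbit_def)
  have Q'_inv: "V (inv g x) (fderiv (inv g) x (w - V x w 0)) 0 = 0" for x w
  proof -
    obtain b where b: "\<forall>k. norm (V x w k) \<le> b" using bounded by blast
    then have b0: "0 \<le> b" using norm_ge_zero order_trans by blast
    define z where "z = inv g x"
    have z: "x = g z" using C1_diffeoD(5)[OF g] by (simp add: z_def)
    have u: "fderiv (inv g) x (w - V x w 0) = - V x w (- 1)"
      unfolding V_minus1 blinfun.minus_right using fderiv_inv_apply(1)[OF g, of z]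
      by (simp add: z_def[symmetric]) (simp add: z)
    have orb_z: "orbit g x k = orbit g z (k + 1)" and Y_z: "Y x k = Y z (k + 1)" for k
      by (simp_all add: z orb_g Y_shift)
    \<comment> \<open>Time \<open>k\<close> at \<open>z\<close> is time \<open>k - 1\<close> at
      \<open>x\<close>. Cutting the past of \<open>V\<close> after time -2 produces a source
      \<open>- V x w (- 1)\<close> and the value 0 at time 0, so this source lies in the kernel of
      the stable projection at \<open>z\<close>.\<close>
    have "Sol z (- V x w (- 1)) (\<lambda>k. if k \<le> - 1 then V x w (k - 1) else 0)"
      unfolding Sol_def
    proof (intro conjI allI)
      show "\<exists>b. \<forall>k. norm (if k \<le> - 1 then V x w (k - 1) else 0) \<le> b"
        using b b0 by (intro exI[of _ b]) auto
      show "(if k \<le> - 1 then V x w (k - 1) else 0) \<in> local_range (Y z k)" for k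
        using V_range[of x w "k - 1"] by (simp add: local_range_0 Y_z)
      show "(if k + 1 \<le> - 1 then V x w (k + 1 - 1) else 0)
        = B z k (if k \<le> - 1 then V x w (k - 1) else 0) + (if k + 1 = 0 then - V x w (- 1) else 0)" for k
        using V_step[of x w "k - 1"] orb_z[of "k - 1"] by (cases "k = - 1") (auto simp: B_def)
    qed
    from V_eqI[OF this] show ?thesis unfolding u z_def by simp
  qed
  have fwd: "fderiv (g ^^ n) x v = V x v (int n)" if "V x v 0 = v" for x v n
  proof (induction n)
    case 0 then show ?case using that fderiv_id[where 'a = 'b] by (simp add: id_def)
  next
    case (Suc n)
    then show ?case
      using V_step[of x v "int n"] by (simp add: fderiv_funpow_Suc(1)[OF dg(1)] B_def orbit_def add.commute del: funpow.simps)
  qed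
  \<comment> \<open>The formula begins at one backward step: at time 0 the solution vanishes, while
    the vector being transported is \<open>v\<close>. The sign is that of
    \<open>V_minus1\<close>.\<close>
  have bwd: "fderiv (inv g ^^ Suc n) x v = - V x v (- int (Suc n))" if v0: "V x v 0 = 0" for x v n
  proof (induction n)
    case 0
    have "v = fderiv g (inv g x) (- V x v (- 1))" using V_minus1[of v x] v0 by (simp add: blinfun.minus_right)
    then have "fderiv (inv g) x v = - V x v (- 1)"
      using fderiv_inv_apply(1)[OF g, of "inv g x" "- V x v (- 1)"] C1_diffeoD(5)[OF g, of x] by simp
    then show ?case by simp
  next
    case (Suc n)
    define p where "p = orbit g x (- int (Suc (Suc n)))"
    have gp: "g p = (inv g ^^ Suc n) x"
      using orb1[of x "- int (Suc (Suc n))"] by (simp add: p_def orbit_def nat_add_distrib del: funpow.simps)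
    have "V x v (- int (Suc n)) = fderiv g p (V x v (- int (Suc (Suc n))))"
      using V_step[of x v "- int (Suc (Suc n))"] by (simp add: B_def p_def)
    then show ?case
      unfolding fderiv_funpow_Suc(1)[OF dg(2), of "Suc n"] Suc gp[symmetric]
      by (simp add: blinfun.minus_right fderiv_inv_apply(1)[OF g])
  qed
  have grow: "C1 * norm v * m ^ n \<le> (C1 + 1) * m ^ n * norm v" for v :: 'b and n
    using m by (simp add: algebra_simps)
  show ?thesis
  proof (rule generalized_hyperbolic_withI[of _ _ P' Q'])
    fix x
    show "P' x o\<^sub>L P' x = P' x" "Q' x o\<^sub>L Q' x = Q' x"
      using V_lincomb[of x 1 _ "- 1"] by (auto intro!: blinfun_eqI simp: idem)
    show "P' x + Q' x = id_blinfun" by (simp add: Q'_def)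
    show "norm (P' x) \<le> C1 + 1" "norm (Q' x) \<le> C1 + 1" using P'_norm[of x] Q'_norm[of x] by auto
    show "fderiv g x ` range (P' x) \<subseteq> range (P' (g x))"
      by (auto simp del: P' simp: image_iff) (metis P' P'_inv)
    show "fderiv (inv g) x ` range (Q' x) \<subseteq> range (Q' (inv g x))"
    proof clarify
      fix w
      have "fderiv (inv g) x (Q' x w) = Q' (inv g x) (fderiv (inv g) x (Q' x w))" by (simp add: Q'_inv)
      then show "fderiv (inv g) x (Q' x w) \<in> range (Q' (inv g x))" by blast
    qed
    fix n :: nat assume n: "0 < n"
    show "norm (fderiv (g ^^ n) x v) \<le> (C1 + 1) * m ^ n * norm v" if "v \<in> range (P' x)" for v
    proof -
      have "V x v 0 = v" using that by (auto simp: idem)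
      then show ?thesis
        using V_bound[of x v "int n"] grow[of v n] by (simp add: fwd)
    qed
    show "norm (fderiv (inv g ^^ n) x v) \<le> (C1 + 1) * m ^ n * norm v" if "v \<in> range (Q' x)" for v
    proof -
      have "V x v 0 = 0" using that V_lincomb[of x 1 _ "- 1"] by (auto simp: idem)
      moreover obtain k where k: "n = Suc k" using n gr0_implies_Suc by blast
      ultimately have "norm (fderiv (inv g ^^ n) x v) = norm (V x v (- int n))"
        unfolding k by (subst bwd) simp_all
      then show ?thesis using V_bound[of x v "- int n"] grow[of v n] by simp
    qed
  qed (use m C1 in auto)
qed

lemma hyperbolicity_robust:
  assumes m: "lam < m" "m < 1"
  shows "\<exists>\<delta>>0. \<exists>C1>0. \<forall>g\<in>uniform_diffeos. C1_dist g f < ennreal \<delta> \<longrightarrow> generalized_hyperbolic_with g C1 m"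
proof -
  obtain M d0 where M: "0 < M" "0 < d0"
    and shadow: "\<And>d. \<lbrakk>0 < d; d < d0\<rbrakk> \<Longrightarrow> \<exists>\<Phi>. \<forall>y. pseudotrajectory f d UNIV y \<longrightarrow>
      exact_trajectory f (\<Phi> y) \<and> (\<forall>k. norm (\<Phi> y k - y k) \<le> M * d) \<and>
      (\<forall>m. \<Phi> (\<lambda>k. y (k + m)) = (\<lambda>k. \<Phi> y (k + m)))"
    using equivariant_shadowing by blast
  obtain e C1 where e: "0 < e" "0 < C1"
    and exists: "\<And>y B w. \<lbrakk>exact_trajectory f y; \<And>k. norm (B k - fderiv f (y k)) \<le> e\<rbrakk> \<Longrightarrow>
      \<exists>v. (\<forall>k. v k \<in> local_range (y k)) \<and>
        (\<forall>k. v (k + 1) = blinfun_apply (B k) (v k) + (if k + 1 = 0 then w else 0)) \<and>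
        (\<forall>k. norm (v k) \<le> C1 * norm w * m ^ nat \<bar>k\<bar>)"
    and unique: "\<And>y B v b k. \<lbrakk>exact_trajectory f y; \<And>k. norm (B k - fderiv f (y k)) \<le> e; \<And>k. v k \<in> local_range (y k);
      \<And>k. v (k + 1) = blinfun_apply (B k) (v k); \<And>k. norm (v k) \<le> b\<rbrakk> \<Longrightarrow> v k = 0"
    using perturbed_cocycle[OF m(1) less_imp_le[OF m(2)]] by blast
  obtain t where t: "0 < t" "\<And>x y. norm (x - y) \<le> t \<Longrightarrow> norm (fderiv f x - fderiv f y) \<le> e / 2"
    using deriv_close[of "e / 2"] e by auto
  \<comment> \<open>The three bounds make \<open>g\<close>-orbits shadowable pseudotrajectories of
    \<open>f\<close>, make the derivative of \<open>f\<close> vary by at most \<open>e / 2\<close>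
    between an orbit and its shadow, and bound the difference of the derivatives of \<open>g\<close>
    and \<open>f\<close> by \<open>e / 2\<close>.\<close>
  define \<delta> where "\<delta> = min (d0 / 2) (min (t / M) (e / 2))"
  have \<delta>: "0 < \<delta>" "\<delta> < d0" "\<delta> \<le> t / M" "\<delta> \<le> e / 2"
    using M t e by (simp_all add: \<delta>_def min_def)
  have M\<delta>: "M * \<delta> \<le> t" using \<delta> M by (simp add: pos_le_divide_eq mult.commute)
  obtain \<Phi> where \<Phi>: "\<And>y. pseudotrajectory f \<delta> UNIV y \<Longrightarrow> exact_trajectory f (\<Phi> y)"
    "\<And>y k. pseudotrajectory f \<delta> UNIV y \<Longrightarrow> norm (\<Phi> y k - y k) \<le> M * \<delta>"
    "\<And>y m. pseudotrajectory f \<delta> UNIV y \<Longrightarrow> \<Phi> (\<lambda>k. y (k + m)) = (\<lambda>k. \<Phi> y (k + m))"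
    using shadow[OF \<delta>(1,2)] by metis
  have "generalized_hyperbolic_with g (C1 + 1) m"
    if g: "g \<in> uniform_diffeos" and dist: "C1_dist g f < ennreal \<delta>" for g
  proof -
    have gd: "C1_diffeo g" using g by (simp add: uniform_diffeos_def)
    note bij = C1_diffeoD(1)[OF gd]
    have "ennreal (norm (g x - f x)) \<le> C1_dist g f" "ennreal (norm (fderiv g x - fderiv f x)) \<le> C1_dist g f" for x
      unfolding C1_dist_def by (rule add_increasing2 add_increasing, simp, rule SUP_upper, simp)+
    then have near: "norm (g x - f x) \<le> \<delta>" "norm (fderiv g x - fderiv f x) \<le> \<delta>" for x
      using dist \<delta>(1) by (metis ennreal_less_iff le_less_trans norm_ge_zero order_less_imp_le)+
    have ps: "pseudotrajectory f \<delta> UNIV (orbit g x)" for x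
      using exact_trajectory_orbit[OF bij, of x] near by (simp add: pseudotrajectory_def exact_trajectory_def)
    \<comment> \<open>Since the orbit of \<open>g x\<close> is the shifted orbit of
      \<open>x\<close>, equivariance of \<open>\<Phi>\<close> gives the shift rule for
      \<open>Y\<close>; independently chosen shadows would not be compatible along an orbit.\<close>
    define Y where "Y x = \<Phi> (orbit g x)" for x
    have Y: "exact_trajectory f (Y x)" for x unfolding Y_def by (rule \<Phi>(1)[OF ps])
    have close: "norm (fderiv g (orbit g x k) - fderiv f (Y x k)) \<le> e" for x k
    proof -
      have "norm (fderiv f (orbit g x k) - fderiv f (Y x k)) \<le> e / 2"
        using \<Phi>(2)[OF ps, of x k] M\<delta> by (intro t(2)) (simp add: Y_def norm_minus_commute)
      moreover have "norm (fderiv g (orbit g x k) - fderiv f (orbit g x k)) \<le> e / 2"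
        using near(2) \<delta>(4) order_trans by blast
      ultimately show ?thesis
        using norm_triangle_ineq[of "fderiv g (orbit g x k) - fderiv f (orbit g x k)"
          "fderiv f (orbit g x k) - fderiv f (Y x k)"] by simp
    qed
    show ?thesis
    proof (rule perturbed_splitting[of m C1 g Y])
      show "Y (g x) k = Y x (k + 1)" for x k
        using fun_cong[OF \<Phi>(3)[OF ps, of x 1], of k] orbit_shift[OF bij, of x 1]
        by (simp add: Y_def orbit_def)
      show "v k = 0" if "\<And>k. v k \<in> local_range (Y x k)"
        "\<And>k. v (k + 1) = fderiv g (orbit g x k) (v k)" "\<And>k. norm (v k) \<le> b" for x v b k
        by (rule unique[OF Y close that])
    qed (use m lam e gd exists[OF Y close] in auto)
  qed
  moreover have "0 < C1 + 1" using e(2) by simp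
  ultimately show ?thesis using \<delta>(1) by blast
qed

end

section \<open>Passage from the definitions to the locale, and conclusion\<close>

lemma uniform_diffeo_hyperbolic:
  assumes f: "f \<in> uniform_diffeos" and h: "generalized_hyperbolic_with f C lam"
  obtains P Q R where "hyperbolic_diffeo f P Q C lam R"
proof -
  obtain R r where f1: "C1_diffeo f" and R: "0 < R" "\<forall>x. norm (fderiv f x) \<le> R \<and> norm (fderiv (inv f) x) \<le> R"
    and r: "(r \<longlongrightarrow> 0) (at_right (0::real))"
    and fr: "\<And>x v. v \<noteq> 0 \<Longrightarrow> norm (fderiv f (x + v) - fderiv f x) \<le> r (norm v)"
    using f unfolding uniform_diffeos_def by blast
  have unif: "\<exists>t>0. \<forall>x v. norm v \<le> t \<longrightarrow> norm (fderiv f (x + v) - fderiv f x) \<le> e" if e: "0 < e" for e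
  proof -
    have "\<forall>\<^sub>F z in at_right 0. r z < e" using r e by (rule order_tendstoD(2))
    then obtain b where b: "0 < b" "\<And>z. 0 < z \<Longrightarrow> z < b \<Longrightarrow> r z < e"
      unfolding eventually_at_right_field by auto
    have "norm (fderiv f (x + v) - fderiv f x) \<le> e" if "norm v \<le> b / 2" for x v
    proof (cases "v = 0")
      case False
      then have "r (norm v) < e" using that b by (intro b(2)) auto
      then show ?thesis using fr[OF False, of x] by simp
    qed (use e in simp)
    then show ?thesis using b(1) by (intro exI[of _ "b / 2"]) auto
  qed
  obtain P Q :: "'a \<Rightarrow> 'a \<Rightarrow>\<^sub>L 'a" where "0 < C" "0 < lam" "lam < 1" and "\<forall>x.
        P x o\<^sub>L P x = P x \<and> Q x o\<^sub>L Q x = Q x \<and>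
        P x + Q x = id_blinfun \<and> norm (P x) \<le> C \<and> norm (Q x) \<le> C \<and>
        fderiv f x ` range (P x) \<subseteq> range (P (f x)) \<and>
        fderiv (inv f) x ` range (Q x) \<subseteq> range (Q (inv f x)) \<and>
        (\<forall>n>0. (\<forall>v \<in> range (P x). norm (fderiv (f ^^ n) x v) \<le> C * lam ^ n * norm v) \<and>
               (\<forall>v \<in> range (Q x). norm (fderiv (inv f ^^ n) x v) \<le> C * lam ^ n * norm v))"
    using h unfolding generalized_hyperbolic_with_def by blast
  then have "hyperbolic_diffeo f P Q C lam R"
    using f1 R unif unfolding hyperbolic_diffeo_def by (intro conjI allI impI) blast+
  then show ?thesis by (rule that)
qed

theorem theorem11:
  fixes f :: "'b::banach \<Rightarrow> 'b"
  assumes "f \<in> uniform_diffeos"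
    and "generalized_hyperbolic f"
  shows "Lipschitz_shadowing f \<and>
    Lipschitz_periodic_shadowing f \<and>
    closure (Per f) = CR f \<and>
    (\<forall>C lam. generalized_hyperbolic_with f C lam \<longrightarrow>
       (\<forall>lam1. lam < lam1 \<and> lam1 < 1 \<longrightarrow>
          (\<exists>\<delta>>0. \<exists>C\<^sub>1>0. \<forall>g \<in> uniform_diffeos.
             C1_dist g f < ennreal \<delta> \<longrightarrow> generalized_hyperbolic_with g C\<^sub>1 lam1)))"
proof -
  obtain C lam where "generalized_hyperbolic_with f C lam"
    using assms(2) by (auto simp: generalized_hyperbolic_def)
  then obtain P Q R where "hyperbolic_diffeo f P Q C lam R"
    using uniform_diffeo_hyperbolic[OF assms(1)] by blast
  then interpret hyperbolic_diffeo f P Q C lam R .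
  \<comment> \<open>Robustness is claimed for every admissible pair of constants, so the locale is
    entered anew with a splitting belonging to each pair, not with the one interpreted
    above.\<close>
  have "\<exists>\<delta>>0. \<exists>C1>0. \<forall>g\<in>uniform_diffeos. C1_dist g f < ennreal \<delta> \<longrightarrow> generalized_hyperbolic_with g C1 lam1"
    if "generalized_hyperbolic_with f C lam" "lam < lam1" "lam1 < 1" for C lam lam1
    using uniform_diffeo_hyperbolic[OF assms(1) that(1)] hyperbolic_diffeo.hyperbolicity_robust that(2,3)
    by (metis (no_types, lifting))
  then show ?thesis
    using Lipschitz_shadowing Lipschitz_periodic_shadowing CR_subset_closure_Per closure_Per_subset_CR by blast
qed

end
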